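(* Suppose the prime $p$ is generic for the crystallographic group $G=[k,l,m]$ (rank $4$). Let $V$, $V_0$, $V_3$, $V_{0,3}$ be non-singular, and let $G_0^p$, $G_3^p$ be of orthogonal type. Let $\epsilon(V_{0,3})=\pm1$ be the parameter associated with the plane $V_{0,3}$. (a) Then $G^p$ is not a (string) C-group if $p>2l+\epsilon(V_{0,3})$. (b) If $G_0^p=O(V_0)$ and $G_3^p=O(V_3)$ (as groups acting on $V_0$, $V_3$, respectively), then $G^p$ is a (string) C-group if and only if $p=l+\epsilon(V_{0,3})$.
   Context: Setting. $G=\langle r_0,\dots,r_{n-1}\rangle=[p_1,\dots,p_{n-1}]$ denotes a crystallographic Coxeter group with string Coxeter diagram (nodes $0,\dots,n-1$; the branch joining nodes $i-1$ and $i$ is marked $p_i$; $p_i=2$ means no branch), so each $p_i\in\{2,3,4,6,\infty\}$, in its standard representation as a reflection group on real $n$-space; here $n=4$. (Non-singularity of $V_{0,3}$ forces $l\ne\infty$.) A basic system is a basis $b_0,\dots,b_{n-1}$ of suitably rescaled simple roots: $b_i\cdot b_i>0$, $b_{i-1}\cdot b_i=-\cos(\pi/p_i)\sqrt{(b_{i-1}\cdot b_{i-1})(b_i\cdot b_i)}$ (with $\cos(\pi/\infty)=1$), $b_i\cdot b_j=0$ for $|i-j|\ge2$, $r_i(x)=x-2\frac{x\cdot b_i}{b_i\cdot b_i}b_i$, and all numbers $2\frac{b_i\cdot b_j}{b_i\cdot b_i}$ are integers. The scaling is chosen so that the node labels $b_i\cdot b_i$ are positive integers with no prime divisors other than $2$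 and $3$, and without the prime divisor $3$ on connected components of the diagram having no branch marked $6$. Reduction. For an odd prime $p$, reduce the matrices of the $r_i$ in the basis $(b_i)$ and the Gram matrix $[b_i\cdot b_j]$ modulo $p$. Now $V=\mathbb Z_p^n$ ($\mathbb Z_p=\mathbb Z/p\mathbb Z$) with standard basis $b_0,\dots,b_{n-1}$ and the (possibly singular) symmetric bilinear form $x\cdot y$ given by the reduced Gram matrix; $G^p\le O(V)$ is generated by the reduced $r_i$ (again denoted $r_i$). The prime $p$ is generic for $G$ if $p\ge5$, or $p=3$ and no branch is marked $6$. For $J\subseteq\{0,\dots,n-1\}$, $G_J^p=\langle r_j\mid j\notin J\rangle$ and $V_J=\mathrm{span}\{b_j\mid j\notin J\}$; $G_0^p$, $V_{0,3}$, etc. abbreviate $J=\{0\}$, $J=\{0,3\}$, etc. $G^p$ is a (string) C-group if $\langle r_i\mid i\in I\rangle\cap\langle r_i\mid i\in J\rangle=\langle r_i\mid i\in I\cap J\rangle$ in $G^p$ for all $I,J\subseteq\{0,\dots,n-1\}$. Orthogonal groups. $O(W)$ is the isometry group of a space $W$ with symmetric bilinear form; $W$ is non-singular if $W\cap W^\perp=\{0\}$. For non-isotropic $a$, $r_a(x)=x-2\frac{x\cdot a}{a\cdot a}a$. $O_1(W)$ (resp. $O_2(W)$) is the subgroup of $O(W)$ generated by the reflections $r_a$ with $a\cdot a$ a nonzero square (resp. a non-square) in $\mathbb Z_p$. For non-singular $W$ of dimension $m$ over $\mathbb Z_p$ one writes $O(m,p,\epsilon)=O(W)$, $O_j(m,p,\epsilon)=O_j(W)$,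 where $\epsilon=\epsilon(W)=0$ if $m$ is odd, and for $m$ even $\epsilon=1$ or $-1$ according as the Witt index of $W$ is $m/2$ or not. For a plane $W$, $\epsilon(W)=1$ if and only if $-\det$ of a Gram matrix of $W$ is a square. Orthogonal type. $G_j^p$ ($j=0,3$), viewed as a group acting on $W=V_j$ (the restriction is faithful here), is of orthogonal type if it equals $O(W)$, $O_1(W)$ or $O_2(W)$, excluding the cases $O_1(3,3,0)$, $O_2(3,5,0)$, $O_2(5,3,0)$ (for these three the form is supposed normalized so that the discriminant of $W$ is a square) and excluding $O_j(4,3,-1)$. *)

theory Defs
  imports
    "HOL-Analysis.Analysis"
    "HOL-Algebra.Bij"
    "HOL-Algebra.Generated_Groups"
    "HOL-Library.Extended_Nat"
    "Berlekamp_Zassenhaus.Finite_Field"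
begin

section \<open>Reflections and orthogonal groups\<close>

definition refl :: "('a::field ^ 'n \<Rightarrow> 'a ^ 'n \<Rightarrow> 'a) \<Rightarrow> 'a ^ 'n \<Rightarrow> 'a ^ 'n \<Rightarrow> 'a ^ 'n" where
  "refl f a x = x - (2 * f x a / f a a) *s a"

definition nonsingular :: "('a::field ^ 'n \<Rightarrow> 'a ^ 'n \<Rightarrow> 'a) \<Rightarrow> ('a ^ 'n) set \<Rightarrow> bool" where
  "nonsingular f W \<longleftrightarrow> W \<inter> {x. \<forall>y\<in>W. f x y = 0} = {0}"

definition witt_index :: "('a::field ^ 'n \<Rightarrow> 'a ^ 'n \<Rightarrow> 'a) \<Rightarrow> ('a ^ 'n) set \<Rightarrow> nat" where
  "witt_index f W =
     Max {vec.dim U | U. vec.subspace U \<and> U \<subseteq> W \<and> (\<forall>x\<in>U. \<forall>y\<in>U. f x y = 0)}"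

definition eps :: "('a::field ^ 'n \<Rightarrow> 'a ^ 'n \<Rightarrow> 'a) \<Rightarrow> ('a ^ 'n) set \<Rightarrow> int" where
  "eps f W =
     (if odd (vec.dim W) then 0
      else if 2 * witt_index f W = vec.dim W then 1 else -1)"

definition nonzero_square :: "'a::field \<Rightarrow> bool" where
  "nonzero_square c \<longleftrightarrow> c \<noteq> 0 \<and> (\<exists>s. c = s\<^sup>2)"

definition nonsquare :: "'a::field \<Rightarrow> bool" where
  "nonsquare c \<longleftrightarrow> (\<nexists>s. c = s\<^sup>2)"

text \<open>
  Groups acting on a subspace \<open>W\<close> are subgroups of \<^term>\<open>BijGroup W\<close>; their elements
  are functions that are \<^const>\<open>undefined\<close> outside \<open>W\<close>.
\<close>

definition orth_group :: "('a::field ^ 'n \<Rightarrow> 'a ^ 'n \<Rightarrow> 'a) \<Rightarrow> ('a ^ 'n) set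
    \<Rightarrow> ('a ^ 'n \<Rightarrow> 'a ^ 'n) set" where
  "orth_group f W =
     {g \<in> carrier (BijGroup W).
        (\<forall>x\<in>W. \<forall>y\<in>W. g (x + y) = g x + g y) \<and>
        (\<forall>c. \<forall>x\<in>W. g (c *s x) = c *s g x) \<and>
        (\<forall>x\<in>W. \<forall>y\<in>W. f (g x) (g y) = f x y)}"

definition orth_group1 :: "('a::field ^ 'n \<Rightarrow> 'a ^ 'n \<Rightarrow> 'a) \<Rightarrow> ('a ^ 'n) set
    \<Rightarrow> ('a ^ 'n \<Rightarrow> 'a ^ 'n) set" where
  "orth_group1 f W =
     generate (BijGroup W) {restrict (refl f a) W | a. a \<in> W \<and> nonzero_square (f a a)}"

definition orth_group2 :: "('a::field ^ 'n \<Rightarrow> 'a ^ 'n \<Rightarrow> 'a) \<Rightarrow> ('a ^ 'n) set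
    \<Rightarrow> ('a ^ 'n \<Rightarrow> 'a ^ 'n) set" where
  "orth_group2 f W =
     generate (BijGroup W) {restrict (refl f a) W | a. a \<in> W \<and> nonsquare (f a a)}"

text \<open>
  Determinant of the Gram matrix of a finite set \<open>S\<close> of vectors, by the Leibniz formula
  (independent of any ordering of \<open>S\<close>). The discriminant of \<open>W\<close> is the class modulo
  squares of this determinant, for any basis \<open>S\<close> of \<open>W\<close>.
\<close>

definition gram_det :: "('a::field ^ 'n \<Rightarrow> 'a ^ 'n \<Rightarrow> 'a) \<Rightarrow> ('a ^ 'n) set \<Rightarrow> 'a" where
  "gram_det f S = (\<Sum>\<pi> | \<pi> permutes S. of_int (sign \<pi>) * (\<Prod>x\<in>S. f x (\<pi> x)))"

definition square_disc :: "('a::field ^ 'n \<Rightarrow> 'a ^ 'n \<Rightarrow> 'a) \<Rightarrow> ('a ^ 'n) set \<Rightarrow> bool" where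
  "square_disc f W \<longleftrightarrow>
     (\<exists>S. vec.independent S \<and> vec.span S = W \<and> nonzero_square (gram_det f S))"

text \<open>
  The groups excluded from orthogonal type. In odd dimension, rescaling the form by a
  non-square interchanges the two reflection subgroups and changes the discriminant, so the
  odd-dimensional exclusions refer to a multiple \<open>c f\<close> of the form with square discriminant.
\<close>

definition excluded_type :: "('p::prime_card mod_ring ^ 'n \<Rightarrow> 'p mod_ring ^ 'n \<Rightarrow> 'p mod_ring)
    \<Rightarrow> ('p mod_ring ^ 'n) set \<Rightarrow> ('p mod_ring ^ 'n \<Rightarrow> 'p mod_ring ^ 'n) set \<Rightarrow> bool" where
  "excluded_type f W H \<longleftrightarrow>
     (\<exists>c. c \<noteq> 0 \<and> square_disc (\<lambda>x y. c * f x y) W \<and>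
        (vec.dim W = 3 \<and> CARD('p) = 3 \<and> H = orth_group1 (\<lambda>x y. c * f x y) W \<or>
         vec.dim W = 3 \<and> CARD('p) = 5 \<and> H = orth_group2 (\<lambda>x y. c * f x y) W \<or>
         vec.dim W = 5 \<and> CARD('p) = 3 \<and> H = orth_group2 (\<lambda>x y. c * f x y) W)) \<or>
     vec.dim W = 4 \<and> CARD('p) = 3 \<and> eps f W = -1 \<and>
       (H = orth_group1 f W \<or> H = orth_group2 f W)"

definition orthogonal_type :: "('p::prime_card mod_ring ^ 'n \<Rightarrow> 'p mod_ring ^ 'n \<Rightarrow> 'p mod_ring)
    \<Rightarrow> ('p mod_ring ^ 'n) set \<Rightarrow> ('p mod_ring ^ 'n \<Rightarrow> 'p mod_ring ^ 'n) set \<Rightarrow> bool" where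
  "orthogonal_type f W H \<longleftrightarrow>
     (H = orth_group f W \<or> H = orth_group1 f W \<or> H = orth_group2 f W) \<and>
     \<not> excluded_type f W H"


section \<open>Basic systems for crystallographic groups \<open>[k, l, m]\<close>\<close>

text \<open>
  The nodes of the diagram are the elements \<open>0, 1, 2, 3\<close> of the type \<open>4\<close>. Distinct
  non-consecutive nodes get the mark 2 (no branch); values on the diagonal are not used. If the middle mark \<open>l\<close> is infinite, the plane spanned by the
  basis vectors at the nodes 1 and 2 is singular, also after reduction.
\<close>

definition mark :: "enat \<Rightarrow> enat \<Rightarrow> enat \<Rightarrow> 4 \<Rightarrow> 4 \<Rightarrow> enat" where
  "mark k l m i j =
     (if {i, j} = {0, 1} then k
      else if {i, j} = {1, 2} then l
      else if {i, j} = {2, 3} then m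
      else 2)"

definition cos_mark :: "enat \<Rightarrow> real" where
  "cos_mark q = (case q of enat n \<Rightarrow> cos (pi / real n) | \<infinity> \<Rightarrow> 1)"

definition diagram_edges :: "enat \<Rightarrow> enat \<Rightarrow> enat \<Rightarrow> (4 \<times> 4) set" where
  "diagram_edges k l m = {(i, j). mark k l m i j \<noteq> 2}"

definition basic_system ::
    "enat \<Rightarrow> enat \<Rightarrow> enat \<Rightarrow> (real ^ 4 \<Rightarrow> real ^ 4 \<Rightarrow> real) \<Rightarrow> (4 \<Rightarrow> real ^ 4) \<Rightarrow> bool" where
  "basic_system k l m B b \<longleftrightarrow>
     {k, l, m} \<subseteq> {2, 3, 4, 6, \<infinity>} \<and>
     bilinear B \<and> (\<forall>x y. B x y = B y x) \<and>
     inj b \<and> independent (range b) \<and> span (range b) = UNIV \<and>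
     (\<forall>i. B (b i) (b i) > 0) \<and>
     (\<forall>i j. i \<noteq> j \<longrightarrow>
        B (b i) (b j) = - cos_mark (mark k l m i j) * sqrt (B (b i) (b i) * B (b j) (b j))) \<and>
     (\<forall>i j. 2 * B (b i) (b j) / B (b i) (b i) \<in> \<int>) \<and>
     (\<forall>i. \<exists>a::nat. B (b i) (b i) = real a \<and> a > 0 \<and>
        (\<forall>q. prime q \<and> q dvd a \<longrightarrow> q = 2 \<or> q = 3) \<and>
        ((\<forall>j j'. (i, j) \<in> (diagram_edges k l m)\<^sup>* \<longrightarrow> mark k l m j j' \<noteq> 6) \<longrightarrow> \<not> 3 dvd a))"


section \<open>Reduction modulo a prime\<close>

text \<open>
  Matrices of the generators have integral entries, but a basic system may have half-integral
  inner products (for a branch marked 3, for instance). As \<open>p\<close> is odd, these can be reduced: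
  if \<open>2 * x\<close> is an integer, then \<open>red x\<close> is the residue class of \<open>x\<close>.
\<close>

definition red :: "real \<Rightarrow> 'p::prime_card mod_ring" where
  "red x = of_int \<lfloor>2 * x\<rfloor> / 2"

definition basis_matrix :: "(4 \<Rightarrow> real ^ 4) \<Rightarrow> (real ^ 4 \<Rightarrow> real ^ 4) \<Rightarrow> real ^ 4 ^ 4" where
  "basis_matrix b g = (\<chi> i j. representation (range b) (g (b j)) (b i))"

definition red_form :: "(real ^ 4 \<Rightarrow> real ^ 4 \<Rightarrow> real) \<Rightarrow> (4 \<Rightarrow> real ^ 4)
    \<Rightarrow> 'p::prime_card mod_ring ^ 4 \<Rightarrow> 'p mod_ring ^ 4 \<Rightarrow> 'p mod_ring" where
  "red_form B b x y = (\<Sum>i\<in>UNIV. \<Sum>j\<in>UNIV. x $ i * red (B (b i) (b j)) * y $ j)"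

definition red_refl :: "(real ^ 4 \<Rightarrow> real ^ 4 \<Rightarrow> real) \<Rightarrow> (4 \<Rightarrow> real ^ 4) \<Rightarrow> 4
    \<Rightarrow> 'p::prime_card mod_ring ^ 4 \<Rightarrow> 'p mod_ring ^ 4" where
  "red_refl B b i x = (\<chi> s t. red (basis_matrix b (refl B (b i)) $ s $ t)) *v x"

definition generic_prime :: "nat \<Rightarrow> enat \<Rightarrow> enat \<Rightarrow> enat \<Rightarrow> bool" where
  "generic_prime p k l m \<longleftrightarrow> prime p \<and> (p \<ge> 5 \<or> p = 3 \<and> 6 \<notin> {k, l, m})"

definition subgroup_on :: "(4 \<Rightarrow> 'a::field ^ 4 \<Rightarrow> 'a ^ 4) \<Rightarrow> 4 set \<Rightarrow> ('a ^ 4 \<Rightarrow> 'a ^ 4) set" where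
  "subgroup_on r I = generate (BijGroup UNIV) (r ` I)"

definition subgroup_omit :: "(4 \<Rightarrow> 'a::field ^ 4 \<Rightarrow> 'a ^ 4) \<Rightarrow> 4 set \<Rightarrow> ('a ^ 4 \<Rightarrow> 'a ^ 4) set" where
  "subgroup_omit r J = subgroup_on r (- J)"

definition subspace_omit :: "4 set \<Rightarrow> ('a::field ^ 4) set" where
  "subspace_omit J = vec.span ((\<lambda>j. axis j 1) ` (- J))"

definition acting_on :: "('v \<Rightarrow> 'v) set \<Rightarrow> 'v set \<Rightarrow> ('v \<Rightarrow> 'v) set" where
  "acting_on H W = (\<lambda>g. restrict g W) ` H"

definition C_group :: "(4 \<Rightarrow> 'a::field ^ 4 \<Rightarrow> 'a ^ 4) \<Rightarrow> bool" where
  "C_group r \<longleftrightarrow> (\<forall>I J. subgroup_on r I \<inter> subgroup_on r J = subgroup_on r (I \<inter> J))"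

end

theory Submission
  imports Defs
begin

text \<open>
  Let \<open>E(W)\<close> be the group of isometries \<open>g\<close> of the reduced space for which all displacements
  \<open>g x - x\<close> lie in the subspace \<open>W\<close> (\<open>isometries_along\<close>). A group generated by some of the reflections
  is contained in \<open>E(W)\<close> for the span \<open>W\<close> of their roots, clearly \<open>E(W) \<inter> E(W') = E(W \<inter> W')\<close>, and for
  nonsingular \<open>W\<close> an element of \<open>E(W)\<close> is determined by its restriction to \<open>W\<close>
  (\<open>isometries_along_eqI\<close>). So everything comes down to comparing three subgroups of the orthogonal
  group \<open>E(P)\<close> of the plane \<open>P\<close> spanned by the two middle roots: the group itself, the dihedral group
  \<open>D\<close> generated by the two middle reflections, and the intersection of the two groups obtained by
  omitting an end node, which lies between them.

  The plane is identified with a quadratic algebra with basis 1 and \<open>\<surd>d\<close>, where \<open>d\<close> is minus the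
  discriminant up to squares. The rotations are the multiplications by elements of norm 1, and the
  points of the conic \<open>x\<^sup>2 - d y\<^sup>2 = 1\<close> are counted by projection from one of them: there are \<open>p - \<epsilon>\<close>
  (\<open>card_conic_eps\<close>), so \<open>E(P)\<close> has order \<open>2 (p - \<epsilon>)\<close>. The product of the two middle reflections is a
  rotation with trace \<open>2 cos (2 \<pi> / l)\<close>, reduced modulo \<open>p\<close>; this forces its order to be \<open>l\<close>, so \<open>D\<close>
  has order \<open>2 l\<close> (\<open>dihedral_group\<close>).

  For part (a), each of the two groups of orthogonal type contains all reflections whose roots have
  some norm, depending on the group, and the plane has roots of every nonzero norm. The square of a
  rotation of the plane is the product of the reflections along a root and a rotated copy of it, so
  it belongs to both groups whatever these norms are (\<open>rot_squares_in_group\<close>). Together with one of the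
  middle reflections the squares of rotations yield at least \<open>p - \<epsilon>\<close> elements of the intersection,
  which is too many for \<open>D\<close> if \<open>p - \<epsilon> > 2 l\<close>.

  For part (b), the two groups are \<open>E(V_0)\<close> and \<open>E(V_3)\<close>, so they intersect in \<open>E(P)\<close>, which equals \<open>D\<close>
  if and only if \<open>p - \<epsilon> = l\<close>. This one intersection decides about the C-group property: in every
  other pair of incomparable subsets of the generators, the subsets share at most one generator, or one
  of them splits into two commuting parts, and then the intersection is as small as it should be
  (\<open>C_group_iff\<close>).
\<close>

section \<open>Groups generated by involutions\<close>

lemma BijGroup_UNIV:
  "carrier (BijGroup UNIV) = {g. bij g}"
  "\<one>\<^bsub>BijGroup UNIV\<^esub> = id"
  "bij g \<Longrightarrow> bij h \<Longrightarrow> g \<otimes>\<^bsub>BijGroup UNIV\<^esub> h = g \<circ> h"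
  by (auto simp: BijGroup_def Bij_def compose_def restrict_def fun_eq_iff)

locale involutions =
  fixes r :: "4 \<Rightarrow> 'a::field ^ 4 \<Rightarrow> 'a ^ 4"
  assumes invol: "r i \<circ> r i = id"
begin

lemma bij_r: "bij (r i)"
  using invol o_bij by blast

lemma bij_subgroup_on: "g \<in> subgroup_on r I \<Longrightarrow> bij g"
  using group.generate_in_carrier[OF group_BijGroup[of UNIV], of "r ` I" g] bij_r
  unfolding subgroup_on_def BijGroup_UNIV by auto

lemma subgroup_on_id: "id \<in> subgroup_on r I"
  unfolding subgroup_on_def using generate.one[of "BijGroup UNIV"] by (simp add: BijGroup_UNIV)

lemma subgroup_on_r: "i \<in> I \<Longrightarrow> r i \<in> subgroup_on r I"
  unfolding subgroup_on_def by (auto intro: generate.incl)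

lemma subgroup_on_comp:
  assumes "g \<in> subgroup_on r I" "h \<in> subgroup_on r I" shows "g \<circ> h \<in> subgroup_on r I"
  using generate.eng[OF assms[unfolded subgroup_on_def]] assms[THEN bij_subgroup_on]
  by (simp add: BijGroup_UNIV subgroup_on_def)

lemma subgroup_on_mono: "I \<subseteq> J \<Longrightarrow> subgroup_on r I \<subseteq> subgroup_on r J"
  unfolding subgroup_on_def by (intro group.mono_generate group_BijGroup image_mono)

lemma inv_r: "inv\<^bsub>BijGroup UNIV\<^esub> (r i) = r i"
  by (rule group.inv_equality[OF group_BijGroup]) (auto simp: BijGroup_UNIV bij_r invol)

text \<open>
  The generators are their own inverses, so every element of the group is a word in them
  and can be built up by multiplying on the left by one generator at a time.
\<close>

lemma subgroup_on_induct [consumes 1, case_names id step]: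
  assumes "g \<in> subgroup_on r I" and "P id"
    and step: "\<And>i h. i \<in> I \<Longrightarrow> h \<in> subgroup_on r I \<Longrightarrow> P h \<Longrightarrow> P (r i \<circ> h)"
  shows "P g"
proof -
  have "\<forall>h\<in>subgroup_on r I. P h \<longrightarrow> P (g \<circ> h)"
    using assms(1) unfolding subgroup_on_def
  proof (induction rule: generate.induct)
    case one
    show ?case by (simp add: BijGroup_UNIV)
  next
    case (incl g)
    then show ?case using step unfolding subgroup_on_def by blast
  next
    case (inv g)
    then show ?case using step inv_r unfolding subgroup_on_def by (metis imageE)
  next
    case (eng g1 g2)
    have b: "bij g1" "bij g2"
      using eng(1,2) bij_subgroup_on by (auto simp: subgroup_on_def)
    show ?case
    proof (intro ballI impI)
      fix h assume h: "h \<in> generate (BijGroup UNIV) (r ` I)" "P h"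
      then have "g2 \<circ> h \<in> generate (BijGroup UNIV) (r ` I)"
        using subgroup_on_comp[of g2 I h] eng(2) by (simp add: subgroup_on_def)
      then show "P (g1 \<otimes>\<^bsub>BijGroup UNIV\<^esub> g2 \<circ> h)"
        using eng h b by (metis BijGroup_UNIV(3) comp_assoc)
    qed
  qed
  from this[rule_format, OF subgroup_on_id \<open>P id\<close>] show ?thesis by simp
qed

text \<open>
  A generator with index in \<open>J\<close> can be moved past the part of the word that lies in the group
  of \<open>I\<close>, so the letters of a word can be sorted.
\<close>

lemma subgroup_on_commuting_Un:
  assumes comm: "\<And>i j. i \<in> I \<Longrightarrow> j \<in> J \<Longrightarrow> r i \<circ> r j = r j \<circ> r i"
    and g: "g \<in> subgroup_on r (I \<union> J)"
  obtains h k where "h \<in> subgroup_on r I" "k \<in> subgroup_on r J" "g = h \<circ> k"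
proof -
  have move: "r j \<circ> h = h \<circ> r j" if "j \<in> J" "h \<in> subgroup_on r I" for j h
    using that(2)
  proof (induction rule: subgroup_on_induct)
    case (step i h)
    then show ?case using comm[OF step(1) that(1)] by (metis comp_assoc)
  qed simp
  have "\<exists>h\<in>subgroup_on r I. \<exists>k\<in>subgroup_on r J. g = h \<circ> k"
    using g
  proof (induction rule: subgroup_on_induct)
    case id
    then show ?case using subgroup_on_id by (metis comp_id)
  next
    case (step i g)
    then obtain h k where hk: "h \<in> subgroup_on r I" "k \<in> subgroup_on r J" "g = h \<circ> k" by blast
    show ?case
    proof (cases "i \<in> I")
      case True
      then show ?thesis
        using hk subgroup_on_comp[OF subgroup_on_r[OF True] hk(1)] by (metis comp_assoc)
    next
      case False
      then have i: "i \<in> J" using step by blast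
      then have "r i \<circ> g = h \<circ> (r i \<circ> k)"
        using move[OF i hk(1)] hk(3) by (metis comp_assoc)
      then show ?thesis using hk subgroup_on_comp[OF subgroup_on_r[OF i] hk(2)] by blast
    qed
  qed
  then show thesis using that by blast
qed

lemma subgroup_on_cancel:
  assumes "h \<in> subgroup_on r I" "h \<circ> k \<in> subgroup_on r I" "bij k"
  shows "k \<in> subgroup_on r I"
  using assms
proof (induction arbitrary: k rule: subgroup_on_induct)
  case (step i h)
  have "r i \<circ> (r i \<circ> h \<circ> k) \<in> subgroup_on r I"
    using step.prems(1) subgroup_on_comp[OF subgroup_on_r[OF step.hyps(1)]] by blast
  moreover have "r i \<circ> (r i \<circ> h \<circ> k) = h \<circ> k"
    using invol[of i] by (metis comp_assoc id_comp)
  ultimately show ?case using step by metis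
qed simp

text \<open>
  Conjugation by \<open>r i\<close> inverts the product \<open>\<rho>\<close>, so left multiplication by \<open>r i\<close> and
  by \<open>r j = \<rho> \<circ> r i\<close> maps the powers of \<open>\<rho>\<close> and their products with \<open>r i\<close> among themselves.
  The inverse of \<open>\<rho>\<close> is written as its power with exponent \<open>l - 1\<close>, to keep exponents natural.
\<close>

lemma subgroup_on_two:
  assumes \<rho>: "\<rho> = r j \<circ> r i" and l: "\<rho> ^^ l = id" "l > 0"
  shows "subgroup_on r {i, j} = {\<rho> ^^ n | n. n < l} \<union> {(\<rho> ^^ n) \<circ> r i | n. n < l}"
    (is "_ = ?R \<union> ?S")
proof
  have red: "\<rho> ^^ n = \<rho> ^^ (n mod l)" for n
  proof -
    have "\<rho> ^^ n = \<rho> ^^ (l * (n div l)) \<circ> \<rho> ^^ (n mod l)"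
      by (metis funpow_add mult_div_mod_eq)
    then show ?thesis using l by (simp add: funpow_mult[symmetric])
  qed
  have R: "\<rho> ^^ n \<in> ?R" for n using red[of n] l(2) by (auto intro!: exI[of _ "n mod l"])
  have S: "\<rho> ^^ n \<circ> r i \<in> ?S" for n using red[of n] l(2) by (auto intro!: exI[of _ "n mod l"])
  have rj: "r j = \<rho> \<circ> r i" unfolding \<rho> using invol[of i] by (simp add: comp_assoc)
  have conj: "r i \<circ> \<rho> ^^ n \<circ> r i = \<rho> ^^ ((l - 1) * n)" for n
  proof (induction n)
    case 0
    show ?case using invol by simp
  next
    case (Suc n)
    have "r i \<circ> r j \<circ> \<rho> = id"
      unfolding \<rho> using invol[of i] invol[of j] by (metis comp_assoc comp_id)
    then have inv: "r i \<circ> r j = \<rho> ^^ (l - 1)"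
    proof -
      have "\<rho> \<circ> \<rho> ^^ (l - 1) = id" using l by (metis Suc_diff_1 funpow.simps(2))
      then show ?thesis using \<open>r i \<circ> r j \<circ> \<rho> = id\<close> by (metis comp_assoc comp_id id_comp)
    qed
    have "r i \<circ> \<rho> ^^ Suc n \<circ> r i = (r i \<circ> r j) \<circ> (r i \<circ> \<rho> ^^ n \<circ> r i)"
      by (simp add: \<rho> comp_assoc)
    also have "\<dots> = \<rho> ^^ ((l - 1) * Suc n)"
      unfolding Suc inv mult_Suc_right funpow_add ..
    finally show ?case .
  qed
  have move: "r i \<circ> \<rho> ^^ n = \<rho> ^^ ((l - 1) * n) \<circ> r i" for n
    using arg_cong[OF conj[of n], of "\<lambda>g. g \<circ> r i"] invol[of i] by (simp add: comp_assoc)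
  show "subgroup_on r {i, j} \<subseteq> ?R \<union> ?S"
  proof
    fix g assume "g \<in> subgroup_on r {i, j}"
    then have "\<exists>n. g = \<rho> ^^ n \<or> g = \<rho> ^^ n \<circ> r i"
    proof (induction rule: subgroup_on_induct)
      case id
      then show ?case by (metis funpow_0 eq_id_iff)
    next
      case (step k g)
      have "\<exists>n. r i \<circ> g = \<rho> ^^ n \<or> r i \<circ> g = \<rho> ^^ n \<circ> r i"
      proof -
        from step obtain n where "g = \<rho> ^^ n \<or> g = \<rho> ^^ n \<circ> r i" by blast
        then have "r i \<circ> g = \<rho> ^^ ((l - 1) * n) \<circ> r i \<or> r i \<circ> g = \<rho> ^^ ((l - 1) * n)"
          using move conj by (metis comp_assoc)
        then show ?thesis by blast
      qed
      moreover have "\<exists>n. r j \<circ> g = \<rho> ^^ n \<or> r j \<circ> g = \<rho> ^^ n \<circ> r i"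
      proof -
        from calculation obtain n where
          "r i \<circ> g = \<rho> ^^ n \<or> r i \<circ> g = \<rho> ^^ n \<circ> r i" by blast
        then have "r j \<circ> g = \<rho> ^^ Suc n \<or> r j \<circ> g = \<rho> ^^ Suc n \<circ> r i"
          unfolding rj by (auto simp: comp_assoc)
        then show ?thesis by blast
      qed
      ultimately show ?case using step(1) by blast
    qed
    then show "g \<in> ?R \<union> ?S" using R S by blast
  qed
  have \<rho>_in: "\<rho> \<in> subgroup_on r {i, j}"
    unfolding \<rho> by (intro subgroup_on_comp subgroup_on_r) auto
  have "\<rho> ^^ n \<in> subgroup_on r {i, j}" for n
  proof (induction n)
    case 0
    show ?case using subgroup_on_id by (simp add: id_def)
  next
    case (Suc n)
    then show ?case using subgroup_on_comp[OF \<rho>_in] by (metis funpow.simps(2))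
  qed
  then show "?R \<union> ?S \<subseteq> subgroup_on r {i, j}"
    by (auto intro!: subgroup_on_comp subgroup_on_r)
qed

end

section \<open>Isometries that displace vectors within a subspace\<close>

locale symmetric_form =
  fixes f :: "'a::{field,finite} ^ 'n \<Rightarrow> 'a ^ 'n \<Rightarrow> 'a"
  assumes add_left: "f (x + y) z = f x z + f y z"
    and scale_left: "f (c *s x) y = c * f x y"
    and sym: "f x y = f y x"
    and two_neq_0: "(2::'a) \<noteq> 0"
begin

lemma add_right: "f z (x + y) = f z x + f z y"
  using add_left sym by metis

lemma scale_right: "f x (c *s y) = c * f x y"
  using scale_left sym by metis

lemma zero_left: "f 0 y = 0"
  using scale_left[of 0 0 y] by simp

lemma zero_right: "f y 0 = 0"
  using zero_left sym by metis

lemma minus_left: "f (- x) y = - f x y"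
  using scale_left[of "-1" x y] by simp

lemma diff_left: "f (x - y) z = f x z - f y z"
  using add_left[of x "-y" z] by (simp add: minus_left)

lemma diff_right: "f z (x - y) = f z x - f z y"
  using diff_left sym by metis

lemmas form_simps = add_left add_right scale_left scale_right zero_left zero_right
  diff_left diff_right

text \<open>
  When \<open>W\<close> is nonsingular this is the copy of the orthogonal group of \<open>W\<close> that fixes the
  orthogonal complement of \<open>W\<close> pointwise. Bounding the displacements \<open>g x - x\<close> instead of
  mentioning the complement makes the definition meaningful for singular \<open>W\<close> as well, and turns
  intersections of such groups into intersections of subspaces.
\<close>

definition isometries_along :: "('a ^ 'n) set \<Rightarrow> ('a ^ 'n \<Rightarrow> 'a ^ 'n) set" where
  "isometries_along W =
     {g. bij g \<and> (\<forall>x y. g (x + y) = g x + g y) \<and> (\<forall>c x. g (c *s x) = c *s g x) \<and>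
         (\<forall>x y. f (g x) (g y) = f x y) \<and> (\<forall>x. g x - x \<in> W)}"

lemma isometries_alongD:
  assumes "g \<in> isometries_along W"
  shows "bij g" "g (x + y) = g x + g y" "g (c *s x) = c *s g x" "f (g x) (g y) = f x y"
    "g x - x \<in> W"
  using assms by (auto simp: isometries_along_def)

lemma isometries_along_Int:
  "isometries_along W \<inter> isometries_along W' = isometries_along (W \<inter> W')"
  by (auto simp: isometries_along_def)

lemma id_isometries_along: "vec.subspace W \<Longrightarrow> id \<in> isometries_along W"
  by (auto simp: isometries_along_def vec.subspace_0)

lemma isometries_along_preserves:
  assumes "vec.subspace W" "g \<in> isometries_along W" "w \<in> W"
  shows "g w \<in> W"
  using vec.subspace_add[OF assms(1) isometries_alongD(5)[OF assms(2), of w] assms(3)] by simp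

lemma isometries_along_comp:
  assumes W: "vec.subspace W" and g: "g \<in> isometries_along W" and h: "h \<in> isometries_along W"
  shows "g \<circ> h \<in> isometries_along W"
proof -
  have "g (h x) - x \<in> W" for x
    using vec.subspace_add[OF W isometries_alongD(5)[OF g, of "h x"] isometries_alongD(5)[OF h, of x]]
    by simp
  then show ?thesis
    using g h by (auto simp: isometries_along_def bij_comp)
qed

lemma isometries_along_image:
  assumes W: "vec.subspace W" and g: "g \<in> isometries_along W"
  shows "g ` W = W"
proof (rule endo_inj_surj)
  show "inj_on g W" using isometries_alongD(1)[OF g] by (metis bij_is_inj inj_on_subset top_greatest)
qed (use isometries_along_preserves[OF W g] in auto)

text \<open>
  The displacements at \<open>x\<close> lie in \<open>W\<close>, hence so does \<open>g x - h x\<close>. Since \<open>g\<close> and \<open>h\<close> agree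
  on \<open>W\<close> and map it onto itself, \<open>g x\<close> and \<open>h x\<close> have the same inner product with every
  vector of \<open>W\<close>. A vector of \<open>W\<close> that is orthogonal to \<open>W\<close> vanishes.
\<close>

lemma isometries_along_eqI:
  assumes W: "vec.subspace W" "nonsingular f W"
    and g: "g \<in> isometries_along W" and h: "h \<in> isometries_along W"
    and eq: "\<And>w. w \<in> W \<Longrightarrow> g w = h w"
  shows "g = h"
proof
  fix x
  have "(g x - x) - (h x - x) \<in> W"
    using W g h by (intro vec.subspace_diff isometries_alongD(5))
  then have "g x - h x \<in> W" by simp
  moreover have "f (g x - h x) w' = 0" if "w' \<in> W" for w'
  proof -
    have "w' \<in> g ` W"
      unfolding isometries_along_image[OF W(1) g] by (rule that)
    then obtain w where w: "w' = g w" "w \<in> W" by (rule imageE)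
    have "f (g x) w' = f x w"
      unfolding w(1) by (rule isometries_alongD(4)[OF g])
    moreover have "f (h x) w' = f x w"
      unfolding w(1) eq[OF w(2)] by (rule isometries_alongD(4)[OF h])
    ultimately show ?thesis by (simp add: diff_left)
  qed
  ultimately have "g x - h x \<in> W \<inter> {x. \<forall>y\<in>W. f x y = 0}" by simp
  then have "g x - h x = 0" using W(2) unfolding nonsingular_def by simp
  then show "g x = h x" by simp
qed

lemma refl_invol:
  assumes "f a a \<noteq> 0" shows "refl f a (refl f a x) = x"
proof -
  define t where "t = 2 * f x a / f a a"
  have "2 * f (refl f a x) a / f a a = - t"
    using assms by (simp add: refl_def form_simps t_def field_simps)
  then have "refl f a (refl f a x) = refl f a x + t *s a"
    unfolding refl_def[of f a "refl f a x"] by simp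
  then show ?thesis by (simp add: refl_def t_def)
qed

lemma refl_isometries_along:
  assumes W: "vec.subspace W" and a: "a \<in> W" "f a a \<noteq> 0"
  shows "refl f a \<in> isometries_along W"
  unfolding isometries_along_def
proof (intro CollectI conjI allI)
  show "bij (refl f a)"
    using refl_invol[OF a(2)] by (intro o_bij[of "refl f a"]) auto
  show "refl f a (x + y) = refl f a x + refl f a y" for x y
    by (simp add: refl_def form_simps vec_eq_iff ring_distribs add_divide_distrib)
  show "refl f a (c *s x) = c *s refl f a x" for c x
    by (simp add: refl_def form_simps vec_eq_iff algebra_simps)
  show "f (refl f a x) (refl f a y) = f x y" for x y
  proof -
    define s t where "s = 2 * f x a / f a a" and "t = 2 * f y a / f a a"
    have st: "s * f a a = 2 * f x a" "t * f a a = 2 * f y a"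
      using a(2) by (auto simp: s_def t_def)
    have "f (refl f a x) (refl f a y) = f x y - t * f x a - s * f y a + s * (t * f a a)"
      unfolding refl_def s_def[symmetric] t_def[symmetric]
      by (simp add: form_simps sym[of a y] algebra_simps)
    also have "\<dots> = f x y + (s * f y a - t * f x a)"
      unfolding st by (simp add: algebra_simps)
    also have "s * f y a - t * f x a = 0"
      by (simp add: s_def t_def)
    finally show ?thesis by simp
  qed
  have "- (2 * f x a / f a a) *s a \<in> W" for x
    using W a(1) by (rule vec.subspace_scale)
  then show "refl f a x - x \<in> W" for x
    by (simp add: refl_def)
qed

lemma refl_conjugate:
  assumes g: "g \<in> isometries_along W"
  shows "refl f (g a) \<circ> g = g \<circ> refl f a"
proof
  fix v
  have "g (refl f a v) = g v + g (- (2 * f v a / f a a) *s a)"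
    unfolding isometries_alongD(2)[OF g, symmetric] by (simp add: refl_def)
  also have "\<dots> = refl f (g a) (g v)"
    unfolding isometries_alongD(3)[OF g] refl_def isometries_alongD(4)[OF g] by simp
  finally show "(refl f (g a) \<circ> g) v = (g \<circ> refl f a) v" by simp
qed

lemma restrict_isometries_along:
  assumes W: "vec.subspace W" and g: "g \<in> isometries_along W"
  shows "restrict g W \<in> orth_group f W"
proof -
  have "bij_betw (restrict g W) W W"
    using isometries_along_image[OF W g] isometries_alongD(1)[OF g]
    by (simp add: bij_betw_def inj_on_def bij_def)
  then have "restrict g W \<in> carrier (BijGroup W)"
    by (simp add: BijGroup_def Bij_def)
  then show ?thesis
    unfolding orth_group_def
    using vec.subspace_add[OF W] vec.subspace_scale[OF W]
    by (intro CollectI conjI ballI allI) (simp_all only: restrict_apply' isometries_alongD(2-4)[OF g])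
qed

text \<open>
  The image of \<open>a\<close> is a multiple \<open>c a\<close> with \<open>c\<^sup>2 = 1\<close>, and the line is nonsingular, so the
  value at \<open>a\<close> determines the isometry.
\<close>

lemma isometries_along_line:
  assumes a: "f a a \<noteq> 0" and g: "g \<in> isometries_along (vec.span {a})"
  shows "g = id \<or> g = refl f a"
proof -
  let ?W = "vec.span {a}"
  have W: "?W = range (\<lambda>c. c *s a)" by (rule vec.span_singleton)
  have sub: "vec.subspace ?W" by simp
  have ns: "nonsingular f ?W"
    unfolding nonsingular_def W using a by (auto simp: form_simps)
  have aW: "a \<in> ?W" by (simp add: vec.span_base)
  obtain c where c: "g a = c *s a"
    using isometries_along_preserves[OF sub g aW] W by auto
  then have "c * c = 1"
    using isometries_alongD(4)[OF g, of a a] a by (simp add: form_simps)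
  then have "c = 1 \<or> c = -1" by (simp add: square_eq_1_iff)
  then show ?thesis
  proof
    assume "c = 1"
    then have "g w = id w" if "w \<in> ?W" for w
      using that c isometries_alongD(3)[OF g] by (auto simp: W)
    then show ?thesis
      using isometries_along_eqI[OF sub ns g id_isometries_along[OF sub]] by blast
  next
    assume "c = -1"
    then have "g w = refl f a w" if "w \<in> ?W" for w
      using that c isometries_alongD(3)[OF g] a
      by (auto simp: W refl_def form_simps vec_eq_iff algebra_simps)
    then show ?thesis
      using isometries_along_eqI[OF sub ns g refl_isometries_along[OF sub aW a]] by blast
  qed
qed

end

section \<open>Squares in a finite field of odd characteristic\<close>

text \<open>
  Every square has at most two roots, and 0 has only one.
\<close>

lemma card_squares:
  assumes "(2::'a::{field,finite}) \<noteq> 0"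
  shows "2 * card (range (\<lambda>x::'a. x\<^sup>2)) > CARD('a)"
proof -
  let ?sq = "\<lambda>x::'a. x\<^sup>2"
  have fib: "card {x. ?sq x = y} \<le> 2" for y
  proof (cases "\<exists>x. ?sq x = y")
    case True
    then obtain x where "?sq x = y" by blast
    then have "{x. ?sq x = y} \<subseteq> {x, - x}" by (auto simp: power2_eq_iff)
    then have "card {x. ?sq x = y} \<le> card {x, - x}" by (intro card_mono) auto
    also have "\<dots> \<le> 2" by (simp add: card_insert_if)
    finally show ?thesis .
  qed auto
  let ?U = "\<Union>y\<in>range ?sq - {0}. {x. ?sq x = y}"
  have "(UNIV :: 'a set) \<subseteq> insert 0 ?U" by auto
  then have "CARD('a) \<le> card (insert 0 ?U)" by (intro card_mono) auto
  also have "\<dots> \<le> Suc (card ?U)" by (intro card_insert_le_m1) auto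
  also have "card ?U \<le> (\<Sum>y\<in>range ?sq - {0}. card {x. ?sq x = y})"
    by (rule card_UN_le) simp
  also have "\<dots> \<le> (\<Sum>y\<in>range ?sq - {0}. 2)"
    by (intro sum_mono fib)
  also have "\<dots> = 2 * card (range ?sq - {0})" by simp
  finally have "CARD('a) \<le> Suc (2 * card (range ?sq - {0}))" by simp
  moreover have "(0::'a) \<in> range ?sq" by (auto intro!: image_eqI[of _ _ 0])
  then have "card (range ?sq) = Suc (card (range ?sq - {0}))"
    by (metis card_Suc_Diff1 finite)
  ultimately show ?thesis by linarith
qed

text \<open>
  Squaring identifies 1 and -1, so on a finite set it cannot be surjective.
\<close>

lemma exists_nonsquare:
  assumes "(2::'a::{field,finite}) \<noteq> 0"
  shows "\<exists>c::'a. nonsquare c"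
proof (rule ccontr)
  assume "\<not> ?thesis"
  then have "surj (\<lambda>x::'a. x\<^sup>2)" unfolding nonsquare_def by auto
  then have "inj (\<lambda>x::'a. x\<^sup>2)" by (simp add: finite_UNIV_surj_inj)
  then have "(1::'a) = -1" by (rule injD) simp
  then show False using assms by (metis add.right_inverse one_add_one)
qed

text \<open>
  A nondegenerate binary quadratic form is universal: the two sets of values
  \<open>\<alpha> x\<^sup>2\<close> and \<open>c - \<beta> y\<^sup>2\<close> are too large to be disjoint.
\<close>

lemma binary_form_universal:
  assumes two: "(2::'a::{field,finite}) \<noteq> 0" and nz: "\<alpha> \<noteq> 0" "\<beta> \<noteq> (0::'a)"
  shows "\<exists>x y. \<alpha> * x\<^sup>2 + \<beta> * y\<^sup>2 = c"
proof -
  let ?Q = "range (\<lambda>x::'a. x\<^sup>2)"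
  let ?A = "(\<lambda>q. \<alpha> * q) ` ?Q" and ?B = "(\<lambda>q. c - \<beta> * q) ` ?Q"
  have "card ?A = card ?Q" "card ?B = card ?Q"
    using nz by (auto intro!: card_image inj_onI)
  then have "card (?A \<union> ?B) < card ?A + card ?B"
    using card_squares[OF two] card_mono[of UNIV "?A \<union> ?B"] by simp
  then have "?A \<inter> ?B \<noteq> {}"
    using card_Un_disjoint[of ?A ?B] by fastforce
  then obtain x y where "\<alpha> * x\<^sup>2 = c - \<beta> * y\<^sup>2" by auto
  then show ?thesis by (metis diff_add_cancel)
qed

section \<open>The orthogonal group of a nonsingular plane\<close>

text \<open>
  The second basis vector is normalised so that the norm of \<open>x e1 + y e2\<close> is the fixed multiple
  \<open>f e1 e1\<close> of \<open>x\<^sup>2 - d y\<^sup>2\<close>, the norm form of the quadratic algebra generated by \<open>\<surd>d\<close>. The plane is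
  thereby identified with this algebra and its rotations with the elements of norm 1.
\<close>

locale orthogonal_plane = symmetric_form f
  for f :: "'a::{field,finite} ^ 'n \<Rightarrow> 'a ^ 'n \<Rightarrow> 'a" +
  fixes e1 e2 :: "'a ^ 'n" and d :: 'a
  assumes e1_neq_0: "f e1 e1 \<noteq> 0" and orth: "f e1 e2 = 0"
    and e2: "f e2 e2 = - d * f e1 e1" and d_neq_0: "d \<noteq> 0"
begin

definition pt :: "'a \<Rightarrow> 'a \<Rightarrow> 'a ^ 'n" where
  "pt x y = x *s e1 + y *s e2"

definition plane :: "('a ^ 'n) set" where
  "plane = vec.span {e1, e2}"

lemma subspace_plane: "vec.subspace plane"
  by (simp add: plane_def)

lemma plane_iff: "w \<in> plane \<longleftrightarrow> (\<exists>x y. w = pt x y)"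
proof -
  have "w - x *s e1 = y *s e2 \<longleftrightarrow> w = pt x y" for x y
    by (auto simp: pt_def algebra_simps)
  then show ?thesis
    by (simp add: plane_def vec.span_insert vec.span_singleton image_iff)
qed

lemma pt_in_plane: "pt x y \<in> plane"
  using plane_iff by blast

lemma pt_linear:
  "pt x y + pt x' y' = pt (x + x') (y + y')" "c *s pt x y = pt (c * x) (c * y)"
  "pt 1 0 = e1" "pt 0 1 = e2" "pt 0 0 = 0"
  by (auto simp: pt_def vec_eq_iff algebra_simps)

definition coord1 :: "'a ^ 'n \<Rightarrow> 'a" where
  "coord1 v = f v e1 / f e1 e1"

definition coord2 :: "'a ^ 'n \<Rightarrow> 'a" where
  "coord2 v = f v e2 / f e2 e2"

lemma e2_neq_0: "f e2 e2 \<noteq> 0"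
  using e2 e1_neq_0 d_neq_0 by simp

lemma f_e: "f v e1 = f e1 e1 * coord1 v" "f v e2 = - d * f e1 e1 * coord2 v"
  using e1_neq_0 d_neq_0 by (simp_all add: coord1_def coord2_def e2)

lemma f_pt: "f v (pt x y) = f e1 e1 * (coord1 v * x - d * coord2 v * y)"
  unfolding pt_def add_right scale_right f_e[of v] by (simp add: algebra_simps)

lemma coord_pt [simp]: "coord1 (pt x y) = x" "coord2 (pt x y) = y"
  using e1_neq_0 e2_neq_0 orth sym[of e2 e1]
  by (auto simp: coord1_def coord2_def pt_def form_simps)

lemma coord_add:
  "coord1 (v + w) = coord1 v + coord1 w" "coord2 (v + w) = coord2 v + coord2 w"
  by (auto simp: coord1_def coord2_def form_simps add_divide_distrib)

lemma coord_scale: "coord1 (c *s v) = c * coord1 v" "coord2 (c *s v) = c * coord2 v"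
  by (auto simp: coord1_def coord2_def form_simps)

lemma pt_eq_iff: "pt x y = pt x' y' \<longleftrightarrow> x = x' \<and> y = y'"
  using coord_pt by metis

lemma nonsingular_plane: "nonsingular f plane"
proof -
  have "w = 0" if w_in: "w \<in> plane" and orth: "\<forall>y\<in>plane. f w y = 0" for w
  proof -
    obtain x y where w: "w = pt x y" using w_in plane_iff by blast
    have "f w (pt 1 0) = 0" "f w (pt 0 1) = 0" using orth pt_in_plane by blast+
    then have "x = 0" "y = 0" using e1_neq_0 d_neq_0 by (auto simp: w f_pt)
    then show ?thesis by (simp add: w pt_linear)
  qed
  moreover have "0 \<in> plane" by (rule vec.subspace_0[OF subspace_plane])
  ultimately show ?thesis
    unfolding nonsingular_def by (auto simp: zero_left)
qed

text \<open>
  A nonsingular plane determines its isometries, so identities between them need only be checked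
  on the plane, where they are calculations with coordinates.
\<close>

lemma plane_eqI:
  assumes "g \<in> isometries_along plane" "h \<in> isometries_along plane"
    and "\<And>x y. g (pt x y) = h (pt x y)"
  shows "g = h"
  using assms by (intro isometries_along_eqI[OF subspace_plane nonsingular_plane]) (auto simp: plane_iff)

text \<open>
  A point \<open>(x, y)\<close> stands for \<open>x + y \<surd>d\<close>; \<open>rot x y\<close> multiplies the component
  in the plane by this element and fixes the orthogonal complement.
\<close>

definition rot :: "'a \<Rightarrow> 'a \<Rightarrow> 'a ^ 'n \<Rightarrow> 'a ^ 'n" where
  "rot x y v = v + pt ((x - 1) * coord1 v + d * y * coord2 v) (y * coord1 v + (x - 1) * coord2 v)"

text \<open>
  The elements of norm 1, which are the parameters of the rotations.
\<close>

definition conic :: "('a \<times> 'a) set" where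
  "conic = {(x, y). x\<^sup>2 - d * y\<^sup>2 = 1}"

lemma coord_rot:
  "coord1 (rot x y v) = x * coord1 v + d * y * coord2 v"
  "coord2 (rot x y v) = y * coord1 v + x * coord2 v"
  by (simp_all add: rot_def coord_add algebra_simps)

lemma rot_pt: "rot x y (pt u v) = pt (x * u + d * y * v) (y * u + x * v)"
  by (simp add: rot_def pt_linear algebra_simps)

lemma rot_1: "rot 1 0 = id"
  by (auto simp: rot_def pt_linear)

lemma rot_comp: "rot x y \<circ> rot u v = rot (x * u + d * y * v) (x * v + y * u)"
proof
  fix w
  have "rot x y (rot u v w) = rot u v w
      + pt ((x - 1) * coord1 (rot u v w) + d * y * coord2 (rot u v w))
           (y * coord1 (rot u v w) + (x - 1) * coord2 (rot u v w))"
    by (simp only: rot_def[of x y])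
  also have "\<dots> = rot (x * u + d * y * v) (x * v + y * u) w"
    unfolding coord_rot unfolding rot_def by (simp add: add.assoc pt_linear pt_eq_iff algebra_simps)
  finally show "(rot x y \<circ> rot u v) w = rot (x * u + d * y * v) (x * v + y * u) w" by simp
qed

lemma conic_mult:
  assumes "(x, y) \<in> conic" "(u, v) \<in> conic"
  shows "(x * u + d * y * v, x * v + y * u) \<in> conic"
proof -
  have "(x * u + d * y * v)\<^sup>2 - d * (x * v + y * u)\<^sup>2 = (x\<^sup>2 - d * y\<^sup>2) * (u\<^sup>2 - d * v\<^sup>2)"
    by (simp add: power2_eq_square algebra_simps)
  then show ?thesis using assms by (simp add: conic_def)
qed

lemma conic_conj: "(x, y) \<in> conic \<Longrightarrow> (x, - y) \<in> conic"
  by (simp add: conic_def)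

lemma rot_inverse:
  assumes "(x, y) \<in> conic"
  shows "rot x y \<circ> rot x (- y) = id" "rot x (- y) \<circ> rot x y = id"
  using assms by (simp_all add: rot_comp rot_1[symmetric] conic_def power2_eq_square mult.assoc)

lemma rot_isometries_along:
  assumes xy: "(x, y) \<in> conic" shows "rot x y \<in> isometries_along plane"
  unfolding isometries_along_def
proof (intro CollectI conjI allI)
  show "bij (rot x y)"
    using rot_inverse[OF xy] by (intro o_bij)
  show "rot x y (v + w) = rot x y v + rot x y w" for v w
    by (simp add: rot_def coord_add pt_def vec_eq_iff algebra_simps)
  show "rot x y (c *s v) = c *s rot x y v" for c v
    by (simp add: rot_def coord_scale pt_def vec_eq_iff algebra_simps)
  show "rot x y v - v \<in> plane" for v
    by (simp add: rot_def pt_in_plane)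
  show "f (rot x y v) (rot x y w) = f v w" for v w
  proof -
    define p q p' q' where "p = coord1 v" "q = coord2 v" "p' = coord1 w" "q' = coord2 w"
    define A B where "A = (x - 1) * p' + d * y * q'" "B = y * p' + (x - 1) * q'"
    define A' B' where "A' = (x - 1) * p + d * y * q" "B' = y * p + (x - 1) * q"
    note defs = p_q_p'_q'_def A_B_def A'_B'_def
    have "f (rot x y v) (rot x y w) = f (rot x y v) w + f (rot x y v) (pt A B)"
      unfolding rot_def[of x y w] add_right by (simp add: defs)
    also have "f (rot x y v) w = f v w + f w (pt A' B')"
      unfolding rot_def[of x y v] add_left by (simp add: defs sym[of w])
    also have "f v w + f w (pt A' B') + f (rot x y v) (pt A B) = f v w + f e1 e1 *
        (p' * A' - d * q' * B' + (x * p + d * y * q) * A - d * (y * p + x * q) * B)"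
      unfolding f_pt coord_rot by (simp add: p_q_p'_q'_def algebra_simps)
    also have "p' * A' - d * q' * B' + (x * p + d * y * q) * A - d * (y * p + x * q) * B
        = (x\<^sup>2 - d * y\<^sup>2 - 1) * (p * p' - d * q * q')"
      unfolding A_B_def A'_B'_def by (simp add: power2_eq_square algebra_simps)
    also have "\<dots> = 0" using xy by (simp add: conic_def)
    finally show ?thesis by simp
  qed
qed

abbreviation refl1 :: "'a ^ 'n \<Rightarrow> 'a ^ 'n" where "refl1 \<equiv> refl f e1"

lemma refl1_isometries_along: "refl1 \<in> isometries_along plane"
  by (intro refl_isometries_along subspace_plane e1_neq_0) (metis pt_in_plane pt_linear(3))

lemma refl_pt: "refl f (pt a b) (pt u v) =
    pt (u - 2 * (u * a - d * v * b) / (a\<^sup>2 - d * b\<^sup>2) * a) (v - 2 * (u * a - d * v * b) / (a\<^sup>2 - d * b\<^sup>2) * b)"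
proof -
  have "2 * f (pt u v) (pt a b) / f (pt a b) (pt a b) = 2 * (u * a - d * v * b) / (a\<^sup>2 - d * b\<^sup>2)"
    using e1_neq_0 by (simp add: f_pt power2_eq_square mult.assoc)
  then show ?thesis
    unfolding refl_def by (simp add: pt_def vec_eq_iff algebra_simps)
qed

lemma refl1_pt: "refl1 (pt u v) = pt (- u) v"
  using refl_pt[of 1 0 u v] by (simp add: pt_linear)

lemma refl1_invol: "refl1 \<circ> refl1 = id"
  using refl_invol[OF e1_neq_0] by auto

lemmas isometries_along_plane_comp = isometries_along_comp[OF subspace_plane]

text \<open>
  Conjugation by the reflection along \<open>e1\<close> is the conjugation \<open>\<surd>d \<mapsto> - \<surd>d\<close> of the algebra.
\<close>

lemma refl1_rot: assumes "(x, y) \<in> conic" shows "refl1 \<circ> rot x y = rot x (- y) \<circ> refl1"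
  using assms
  by (intro plane_eqI isometries_along_plane_comp refl1_isometries_along rot_isometries_along conic_conj)
    (auto simp: rot_pt refl1_pt pt_eq_iff)

text \<open>
  The product of the reflections along \<open>a = a\<^sub>1 + a\<^sub>2 \<surd>d\<close> and along \<open>e1\<close> is
  multiplication by \<open>a\<close> divided by its conjugate.
\<close>

lemma refl_eq_rot:
  assumes n: "a\<^sup>2 - d * b\<^sup>2 \<noteq> 0"
  defines "x \<equiv> (a\<^sup>2 + d * b\<^sup>2) / (a\<^sup>2 - d * b\<^sup>2)" and "y \<equiv> 2 * a * b / (a\<^sup>2 - d * b\<^sup>2)"
  shows "(x, y) \<in> conic" "refl f (pt a b) = rot x y \<circ> refl1"
proof -
  define n where "n = a\<^sup>2 - d * b\<^sup>2"
  have n0: "n \<noteq> 0" using n by (simp add: n_def)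
  have "(a\<^sup>2 + d * b\<^sup>2)\<^sup>2 - d * (2 * a * b)\<^sup>2 = n\<^sup>2"
    unfolding n_def by (simp add: power2_eq_square algebra_simps)
  then have "x\<^sup>2 - d * y\<^sup>2 = n\<^sup>2 / n\<^sup>2"
    unfolding x_def y_def n_def[symmetric] power_divide times_divide_eq_right diff_divide_distrib[symmetric]
    by simp
  then show xy: "(x, y) \<in> conic" using n0 by (simp add: conic_def)
  have iso: "refl f (pt a b) \<in> isometries_along plane"
    using n e1_neq_0
    by (intro refl_isometries_along subspace_plane pt_in_plane) (simp add: f_pt power2_eq_square mult.assoc)
  have 1: "u - 2 * (u * a - d * v * b) / n * a = x * - u + d * y * v" for u v
    unfolding x_def y_def n_def[symmetric] using n0
    by (simp add: field_simps) (simp add: n_def algebra_simps power2_eq_square)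
  have 2: "v - 2 * (u * a - d * v * b) / n * b = y * - u + x * v" for u v
    unfolding x_def y_def n_def[symmetric] using n0
    by (simp add: field_simps) (simp add: n_def algebra_simps power2_eq_square)
  show "refl f (pt a b) = rot x y \<circ> refl1"
  proof (rule plane_eqI[OF iso])
    show "rot x y \<circ> refl1 \<in> isometries_along plane"
      using xy by (intro isometries_along_plane_comp refl1_isometries_along rot_isometries_along)
    show "refl f (pt a b) (pt u v) = (rot x y \<circ> refl1) (pt u v)" for u v
      unfolding refl_pt n_def[symmetric] 1 2 by (simp add: rot_pt refl1_pt)
  qed
qed

text \<open>
  A reflection inverts rotations, so the square of a rotation is the product of two
  reflections whose roots have the same length.
\<close>

lemma rot_square_eq_refl_refl:
  assumes a: "f (pt a b) (pt a b) \<noteq> 0" and xy: "(x, y) \<in> conic"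
  shows "rot (x\<^sup>2 + d * y\<^sup>2) (2 * x * y) = refl f (pt a b) \<circ> refl f (rot x (- y) (pt a b))"
proof -
  let ?a = "pt a b"
  have n: "a\<^sup>2 - d * b\<^sup>2 \<noteq> 0"
    using a by (auto simp: f_pt power2_eq_square mult.assoc)
  obtain u v where uv: "(u, v) \<in> conic" "refl f ?a = rot u v \<circ> refl1"
    using refl_eq_rot[OF n] by blast
  have inv: "refl f ?a \<circ> rot x (- y) \<circ> refl f ?a = rot x y"
  proof -
    have "refl f ?a \<circ> rot x (- y) = rot u v \<circ> (refl1 \<circ> rot x (- y))"
      by (simp only: uv comp_assoc)
    also have "\<dots> = (rot u v \<circ> rot x y) \<circ> refl1"
      using refl1_rot[OF conic_conj[OF xy]] by (simp only: comp_assoc minus_minus)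
    also have "rot u v \<circ> rot x y = rot x y \<circ> rot u v"
      by (simp add: rot_comp algebra_simps)
    finally have "refl f ?a \<circ> rot x (- y) = rot x y \<circ> refl f ?a"
      by (simp only: uv comp_assoc)
    moreover have "refl f ?a \<circ> refl f ?a = id" using refl_invol[OF a] by auto
    ultimately show ?thesis by (metis comp_assoc comp_id)
  qed
  let ?g = "rot x (- y)"
  have g: "?g \<in> isometries_along plane" using xy by (intro rot_isometries_along conic_conj)
  have "refl f (?g ?a) \<circ> ?g = ?g \<circ> refl f ?a" by (rule refl_conjugate[OF g])
  then have "refl f (?g ?a) = ?g \<circ> refl f ?a \<circ> rot x y"
    using rot_inverse[OF xy] by (metis comp_assoc comp_id)
  then have "refl f ?a \<circ> refl f (?g ?a) = (refl f ?a \<circ> ?g \<circ> refl f ?a) \<circ> rot x y"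
    by (simp only: comp_assoc)
  then have "refl f ?a \<circ> refl f (?g ?a) = rot x y \<circ> rot x y"
    by (simp only: inv)
  moreover have "rot (x\<^sup>2 + d * y\<^sup>2) (2 * x * y) = rot x y \<circ> rot x y"
    unfolding rot_comp by (rule arg_cong2[of _ _ _ _ rot]) (simp_all add: power2_eq_square)
  ultimately show ?thesis by (simp only:)
qed

text \<open>
  The image of \<open>e1\<close> is a point of the conic, and the image of \<open>e2\<close> is one of the two
  vectors of the right length orthogonal to it.
\<close>

lemma isometries_along_plane_cases:
  assumes g: "g \<in> isometries_along plane"
  shows "\<exists>(x, y)\<in>conic. g = rot x y \<or> g = rot x y \<circ> refl1"
proof -
  have pres: "\<exists>x y. g (pt u v) = pt x y" for u v
    using isometries_along_preserves[OF subspace_plane g pt_in_plane] plane_iff by blast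
  obtain x y where e1: "g (pt 1 0) = pt x y" using pres by blast
  obtain u v where e2: "g (pt 0 1) = pt u v" using pres by blast
  have iso: "f (g v) (g w) = f v w" for v w using isometries_alongD(4)[OF g] .
  have "f e1 e1 * (x * x - d * y * y) = f e1 e1 * 1"
    "f e1 e1 * (u * u - d * v * v) = f e1 e1 * (- d)"
    "f e1 e1 * (x * u - d * y * v) = f e1 e1 * 0"
    using iso[of "pt 1 0" "pt 1 0"] iso[of "pt 0 1" "pt 0 1"] iso[of "pt 1 0" "pt 0 1"]
    by (simp_all add: e1 e2 f_pt)
  then have eqs: "x * x - d * y * y = 1" "u * u - d * v * v = - d" "x * u = d * y * v"
    using e1_neq_0 unfolding mult_cancel_left by auto
  have xy: "(x, y) \<in> conic" using eqs(1) by (simp add: conic_def power2_eq_square mult.assoc)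
  \<comment> \<open>the determinant of \<open>g\<close> on the plane\<close>
  define t where "t = x * v - y * u"
  have "t * d * y = x * (d * y * v) - d * y * y * u"
    by (simp add: t_def algebra_simps)
  also have "\<dots> = (x * x - d * y * y) * u"
    unfolding eqs(3)[symmetric] by (simp add: algebra_simps)
  finally have u: "u = t * d * y" by (simp add: eqs(1))
  have "t * x = x * x * v - y * (x * u)"
    by (simp add: t_def algebra_simps)
  also have "\<dots> = (x * x - d * y * y) * v"
    unfolding eqs(3) by (simp add: algebra_simps)
  finally have v: "v = t * x" by (simp add: eqs(1))
  have "u * u - d * v * v = - d * (t * t) * (x * x - d * y * y)"
    unfolding u v by (simp add: algebra_simps)
  then have "d * (t * t) = d * 1" using eqs(1,2) by simp
  then have "t * t = 1" using d_neq_0 by (metis mult_cancel_left)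
  then have t: "t = 1 \<or> t = -1" by (simp add: square_eq_1_iff)
  have gpt: "g (pt p q) = pt (p * x + q * u) (p * y + q * v)" for p q
  proof -
    have "pt p q = p *s pt 1 0 + q *s pt 0 1" unfolding pt_linear(1,2) by simp
    then have "g (pt p q) = p *s pt x y + q *s pt u v"
      by (simp only: isometries_alongD(2,3)[OF g] e1 e2)
    then show ?thesis by (simp only: pt_linear(1,2))
  qed
  show ?thesis
  proof (cases "t = 1")
    case True
    have "g = rot x y"
      by (rule plane_eqI[OF g rot_isometries_along[OF xy]])
        (simp add: gpt rot_pt pt_eq_iff u v True algebra_simps)
    then show ?thesis using xy by blast
  next
    case False
    then have t: "t = -1" using t by simp
    have xy': "(- x, - y) \<in> conic" using xy by (simp add: conic_def)
    have "g = rot (- x) (- y) \<circ> refl1"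
      by (rule plane_eqI[OF g isometries_along_plane_comp[OF rot_isometries_along[OF xy'] refl1_isometries_along]])
        (simp add: gpt rot_pt refl1_pt pt_eq_iff u v t algebra_simps)
    then show ?thesis using xy' by blast
  qed
qed

lemma rot_eq_iff: "rot x y = rot u v \<longleftrightarrow> x = u \<and> y = v"
proof
  assume "rot x y = rot u v"
  then have "rot x y (pt 1 0) = rot u v (pt 1 0)" by simp
  then show "x = u \<and> y = v" by (simp add: rot_pt pt_eq_iff)
qed simp

lemma rot_neq_rot_refl1:
  assumes "(x, y) \<in> conic" shows "rot x y \<noteq> rot u v \<circ> refl1"
proof
  assume eq: "rot x y = rot u v \<circ> refl1"
  have "rot x y (pt 1 0) = (rot u v \<circ> refl1) (pt 1 0)" "rot x y (pt 0 1) = (rot u v \<circ> refl1) (pt 0 1)"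
    unfolding eq by auto
  then have "x = - u" "y = - v" "d * y = d * v" "x = u"
    by (auto simp: rot_pt refl1_pt pt_eq_iff)
  then have "2 * x = 0" "2 * y = 0" using d_neq_0 by auto
  then have "x = 0" "y = 0" using two_neq_0 by auto
  then show False using assms by (simp add: conic_def)
qed

text \<open>
  The images of \<open>e1\<close> and \<open>e2\<close> reveal the parameters and tell rotations from reflections.
\<close>

lemma card_rotations_reflections:
  assumes S: "S \<subseteq> conic"
  shows "card ((\<lambda>(x, y). rot x y) ` S \<union> (\<lambda>(x, y). rot x y \<circ> refl1) ` S) = 2 * card S"
proof -
  have inj1: "inj_on (\<lambda>(x, y). rot x y) S"
    by (auto simp: inj_on_def rot_eq_iff)
  have inj2: "inj_on (\<lambda>(x, y). rot x y \<circ> refl1) S"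
  proof (intro inj_onI, clarsimp)
    fix x y u v assume "rot x y \<circ> refl1 = rot u v \<circ> refl1"
    then have "rot x y = rot u v" using refl1_invol by (metis comp_assoc comp_id)
    then show "x = u \<and> y = v" by (simp add: rot_eq_iff)
  qed
  have "(\<lambda>(x, y). rot x y) ` S \<inter> (\<lambda>(x, y). rot x y \<circ> refl1) ` S = {}"
    using S rot_neq_rot_refl1 by fastforce
  then show ?thesis
    using inj1 inj2 by (subst card_Un_disjoint) (auto simp: card_image)
qed

lemma isometries_along_plane_eq:
  "isometries_along plane = (\<lambda>(x, y). rot x y) ` conic \<union> (\<lambda>(x, y). rot x y \<circ> refl1) ` conic"
  using isometries_along_plane_cases rot_isometries_along
    isometries_along_plane_comp[OF rot_isometries_along refl1_isometries_along] by fast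

lemma card_isometries_along_plane: "card (isometries_along plane) = 2 * card conic"
  unfolding isometries_along_plane_eq by (rule card_rotations_reflections) simp

lemma conic_factor: "(x, y) \<in> conic \<Longrightarrow> d * y\<^sup>2 = (x - 1) * (1 + x)"
  by (simp add: conic_def power2_eq_square algebra_simps)

text \<open>
  The lines through \<open>(-1, 0)\<close> parametrise the conic by their slopes: the line of slope \<open>t\<close> meets it
  in one further point, unless \<open>d t\<^sup>2 = 1\<close>, when the line is parallel to an asymptote. The point
  \<open>(-1, 0)\<close> itself accounts for the summand 1.
\<close>

lemma card_conic: "card conic + card {t. d * t\<^sup>2 = 1} = CARD('a) + 1"
proof -
  let ?T = "{t. d * t\<^sup>2 \<noteq> 1}"
  let ?F = "\<lambda>t. ((1 + d * t\<^sup>2) / (1 - d * t\<^sup>2), 2 * t / (1 - d * t\<^sup>2))"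
  have "bij_betw ?F ?T (conic - {(-1, 0)})"
  proof (rule bij_betw_byWitness[where f' = "\<lambda>(x, y). y / (1 + x)"])
    show "\<forall>t\<in>?T. (\<lambda>(x, y). y / (1 + x)) (?F t) = t"
    proof
      fix t assume "t \<in> ?T"
      then have n: "1 - d * t\<^sup>2 \<noteq> 0" by auto
      have "1 + (1 + d * t\<^sup>2) / (1 - d * t\<^sup>2) = 2 / (1 - d * t\<^sup>2)"
        using n by (simp add: field_simps)
      then show "(\<lambda>(x, y). y / (1 + x)) (?F t) = t"
        using n two_neq_0 by simp
    qed
    have neq: "1 + x \<noteq> 0" if "(x, y) \<in> conic" "\<not> (x = -1 \<and> y = 0)" for x y
    proof
      assume x: "1 + x = 0"
      then have "y = 0" using conic_factor[OF that(1)] d_neq_0 by simp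
      then show False using that(2) x by (simp add: add_eq_0_iff)
    qed
    show "\<forall>z\<in>conic - {(-1, 0)}. ?F ((\<lambda>(x, y). y / (1 + x)) z) = z"
    proof
      fix z assume z: "z \<in> conic - {(-1, 0)}"
      then obtain x y where zxy: "z = (x, y)" and xy: "(x, y) \<in> conic" "\<not> (x = -1 \<and> y = 0)"
        by (cases z) auto
      have c: "d * y\<^sup>2 = (x - 1) * (1 + x)" and n: "1 + x \<noteq> 0"
        using conic_factor[OF xy(1)] neq[OF xy(1,2)] by auto
      have "d * (y / (1 + x))\<^sup>2 = (d * y\<^sup>2) / ((1 + x) * (1 + x))"
        by (simp add: power2_eq_square)
      also have "\<dots> = (x - 1) / (1 + x)"
        unfolding c using n by simp
      finally have t: "d * (y / (1 + x))\<^sup>2 = (x - 1) / (1 + x)" .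
      have "1 + (x - 1) / (1 + x) = 2 * x / (1 + x)" "1 - (x - 1) / (1 + x) = 2 / (1 + x)"
        using n by (simp_all add: field_simps)
      then show "?F ((\<lambda>(x, y). y / (1 + x)) z) = z"
        using n two_neq_0 by (simp add: t zxy)
    qed
    show "?F ` ?T \<subseteq> conic - {(-1, 0)}"
    proof (rule image_subsetI)
      fix t assume "t \<in> ?T"
      then have n: "1\<^sup>2 - d * t\<^sup>2 \<noteq> 0" by simp
      have "?F t \<in> conic" using refl_eq_rot(1)[OF n] by simp
      moreover have "?F t \<noteq> (-1, 0)"
      proof
        assume "?F t = (-1, 0)"
        then have "t = 0" "(1 + d * t\<^sup>2) / (1 - d * t\<^sup>2) = -1" using n two_neq_0 by auto
        then have "(1::'a) = -1" by simp
        then show False using two_neq_0 by (metis add.right_inverse one_add_one)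
      qed
      ultimately show "?F t \<in> conic - {(-1, 0)}" by simp
    qed
    show "(\<lambda>(x, y). y / (1 + x)) ` (conic - {(-1, 0)}) \<subseteq> ?T"
    proof (rule image_subsetI)
      fix z assume z: "z \<in> conic - {(-1, 0)}"
      then obtain x y where zxy: "z = (x, y)" and xy: "(x, y) \<in> conic" "\<not> (x = -1 \<and> y = 0)"
        by (cases z) auto
      have c: "d * y\<^sup>2 = (x - 1) * (1 + x)" and n: "1 + x \<noteq> 0"
        using conic_factor[OF xy(1)] neq[OF xy(1,2)] by auto
      have "d * (y / (1 + x))\<^sup>2 \<noteq> 1"
      proof
        assume "d * (y / (1 + x))\<^sup>2 = 1"
        then have "d * y\<^sup>2 = (1 + x) * (1 + x)"
          using n by (simp add: power2_eq_square field_simps)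
        then have "x - 1 = 1 + x" using n c by simp
        then have "(2::'a) = 0" by (simp add: algebra_simps)
        then show False using two_neq_0 by simp
      qed
      then show "(\<lambda>(x, y). y / (1 + x)) z \<in> ?T" by (simp add: zxy)
    qed
  qed
  then have "card (conic - {(-1, 0)}) = card ?T" by (simp add: bij_betw_same_card)
  moreover have "(-1, 0) \<in> conic" by (simp add: conic_def)
  then have "card conic = Suc (card (conic - {(-1, 0)}))"
    by (metis card_Suc_Diff1 finite)
  moreover have "card ?T + card {t. d * t\<^sup>2 = 1} = CARD('a)"
  proof -
    have "card (?T \<union> {t. d * t\<^sup>2 = 1}) = card ?T + card {t. d * t\<^sup>2 = 1}"
      by (intro card_Un_disjoint) auto
    moreover have "?T \<union> {t. d * t\<^sup>2 = 1} = UNIV" by auto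
    ultimately show ?thesis by simp
  qed
  ultimately show ?thesis by simp
qed

lemma dim_plane: "vec.dim plane = 2"
proof -
  have "e1 \<noteq> c *s e2" for c
    using pt_eq_iff[of 1 0 0 c] by (simp add: pt_def)
  then have "e1 \<notin> vec.span {e2}" by (auto simp: vec.span_singleton)
  moreover have "e2 \<noteq> 0" using e2_neq_0 by (auto simp: zero_left)
  ultimately have "vec.independent {e1, e2}"
    by (simp add: vec.independent_insert)
  moreover have "e1 \<noteq> e2" using \<open>e1 \<notin> vec.span {e2}\<close> vec.span_base by blast
  ultimately show ?thesis
    unfolding plane_def by (simp add: vec.dim_eq_card_independent)
qed

text \<open>
  The plane has no totally isotropic subspace of dimension 2 because \<open>e1\<close> is not isotropic, and
  an isotropic vector \<open>x e1 + y e2\<close> amounts to a square root \<open>x / y\<close> of \<open>d\<close>.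
\<close>

lemma witt_index_plane: "witt_index f plane = (if \<exists>s. d = s\<^sup>2 then 1 else 0)"
proof -
  let ?iso = "\<lambda>U. vec.subspace U \<and> U \<subseteq> plane \<and> (\<forall>x\<in>U. \<forall>y\<in>U. f x y = 0)"
  let ?S = "{vec.dim U | U. ?iso U}"
  have le: "n \<le> 1" if "n \<in> ?S" for n
  proof -
    obtain U where U: "?iso U" "n = vec.dim U" using \<open>n \<in> ?S\<close> by blast
    have "e1 \<notin> U" using U(1) e1_neq_0 by blast
    moreover have "e1 \<in> plane" using pt_in_plane[of 1 0] by (simp add: pt_linear)
    ultimately have "U \<noteq> plane" by blast
    then have "\<not> vec.dim plane \<le> vec.dim U"
      using U(1) vec.subspace_dim_equal[of U plane] subspace_plane by blast
    then show ?thesis using U(2) dim_plane by simp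
  qed
  have fin: "finite ?S" using le by (intro finite_subset[of ?S "{..1}"]) auto
  show ?thesis
  proof (cases "\<exists>s. d = s\<^sup>2")
    case True
    then obtain s where s: "d = s\<^sup>2" by blast
    let ?a = "pt s 1" and ?U = "vec.span {pt s 1}"
    have "f ?a ?a = 0" by (simp add: f_pt s power2_eq_square)
    then have "\<forall>x\<in>?U. \<forall>y\<in>?U. f x y = 0"
      by (auto simp: vec.span_singleton form_simps)
    moreover have "?U \<subseteq> plane"
      by (intro vec.span_minimal subspace_plane) (simp add: pt_in_plane)
    ultimately have "?iso ?U" by simp
    moreover have "?a \<noteq> 0" using pt_eq_iff[of s 1 0 0] by (simp add: pt_linear)
    then have "vec.independent {?a}" by (simp only: vec.dependent_single not_False_eq_True)
    then have "vec.dim ?U = card {?a}" by (rule vec.dim_span_eq_card_independent)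
    then have "1 = vec.dim ?U" by simp
    ultimately have "1 \<in> ?S" by blast
    then have "Max ?S = 1" by (intro Max_eqI[OF fin] le)
    then show ?thesis using True by (simp only: witt_index_def if_True)
  next
    case False
    have zero: "n = 0" if n: "n \<in> ?S" for n
    proof -
      obtain U where U: "?iso U" "n = vec.dim U" using n by blast
      have "u = 0" if u: "u \<in> U" for u
      proof -
        obtain x y where xy: "u = pt x y" using u U(1) plane_iff by blast
        have "f u u = 0" using u U(1) by blast
        then have eq: "x * x = d * (y * y)" using e1_neq_0 by (simp add: xy f_pt mult.assoc)
        have "y = 0"
        proof (rule ccontr)
          assume "y \<noteq> 0"
          then have "d = (x / y)\<^sup>2" using eq by (simp add: power2_eq_square field_simps)
          then show False using False by blast
        qed
        then show ?thesis using eq by (simp add: xy pt_linear)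
      qed
      then have "U \<subseteq> {0}" by blast
      then show ?thesis using U(2) by simp
    qed
    have zero_in: "0 \<in> ?S"
    proof -
      have "?iso {0}" using subspace_plane vec.subspace_0 by (auto simp: zero_left)
      moreover have "0 = vec.dim ({0} :: ('a ^ 'n) set)" by simp
      ultimately show ?thesis by blast
    qed
    have "Max ?S = 0"
      by (rule Max_eqI[OF fin _ zero_in]) (rule eq_imp_le, rule zero)
    then show ?thesis using False by (simp only: witt_index_def if_False)
  qed
qed

lemma eps_plane: "eps f plane = (if \<exists>s. d = s\<^sup>2 then 1 else -1)"
  by (simp add: eps_def dim_plane witt_index_plane)

text \<open>
  The conic has two asymptotic directions, the square roots of \<open>1 / d\<close>, if \<open>d\<close> is a square, and
  none otherwise.
\<close>

lemma card_conic_eps: "int (card conic) = int CARD('a) - eps f plane"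
proof -
  have "int (card {t. d * t\<^sup>2 = 1}) = 1 + eps f plane"
  proof (cases "\<exists>s. d = s\<^sup>2")
    case True
    then obtain s where s: "d = s\<^sup>2" by blast
    then have s0: "s \<noteq> 0" using d_neq_0 by auto
    have "d * t\<^sup>2 = 1 \<longleftrightarrow> t = 1 / s \<or> t = - (1 / s)" for t
    proof -
      have "d * t\<^sup>2 = 1 \<longleftrightarrow> (s * t)\<^sup>2 = 1" by (simp add: s power_mult_distrib)
      also have "\<dots> \<longleftrightarrow> s * t = 1 \<or> s * t = -1" by (rule power2_eq_1_iff)
      finally show ?thesis using s0 by (auto simp: field_simps)
    qed
    then have "{t. d * t\<^sup>2 = 1} = {1 / s, - (1 / s)}" by blast
    moreover have "1 / s \<noteq> - (1 / s)"
    proof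
      assume "1 / s = - (1 / s)"
      then have "(1::'a) = - 1" using s0 by (simp add: field_simps)
      then show False using two_neq_0 by (metis add.right_inverse one_add_one)
    qed
    ultimately have "card {t. d * t\<^sup>2 = 1} = 2" by simp
    moreover have "eps f plane = 1" using True unfolding eps_plane by simp
    ultimately show ?thesis by simp
  next
    case False
    have "d * t\<^sup>2 \<noteq> 1" for t
    proof
      assume t: "d * t\<^sup>2 = 1"
      then have "t \<noteq> 0" by auto
      then have "d = (1 / t)\<^sup>2" using t by (simp add: power2_eq_square field_simps)
      then show False using False by blast
    qed
    then have "{t. d * t\<^sup>2 = 1} = {}" by blast
    moreover have "eps f plane = - 1" using False unfolding eps_plane by (simp only: if_False)
    ultimately show ?thesis by simp
  qed
  then show ?thesis using card_conic by linarith
qed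

lemma plane_represents: "\<exists>a b. f (pt a b) (pt a b) = c"
proof -
  obtain a b where "f e1 e1 * a\<^sup>2 + (- d * f e1 e1) * b\<^sup>2 = c"
    using binary_form_universal[OF two_neq_0, of "f e1 e1" "- d * f e1 e1" c] e1_neq_0 d_neq_0 by auto
  then have "f (pt a b) (pt a b) = c" by (simp add: f_pt power2_eq_square algebra_simps)
  then show ?thesis by blast
qed

text \<open>
  Squaring in the quadratic algebra, so the parameter of the square of a rotation.
\<close>

abbreviation conic_square :: "'a \<times> 'a \<Rightarrow> 'a \<times> 'a" where
  "conic_square \<equiv> \<lambda>(x, y). (x\<^sup>2 + d * y\<^sup>2, 2 * x * y)"

lemma conic_square_in_conic: "conic_square ` conic \<subseteq> conic"
  using conic_mult by (force simp: power2_eq_square algebra_simps)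

text \<open>
  Two points with the same square differ by a square root of 1, so at most by a sign.
\<close>

lemma conic_square_eqD:
  assumes "(x, y) \<in> conic" "(u, v) \<in> conic" "conic_square (x, y) = conic_square (u, v)"
  shows "(u, v) = (x, y) \<or> (u, v) = (- x, - y)"
proof -
  have eq: "x\<^sup>2 - d * y\<^sup>2 = 1" "u\<^sup>2 - d * v\<^sup>2 = 1" "x\<^sup>2 + d * y\<^sup>2 = u\<^sup>2 + d * v\<^sup>2"
    "2 * (x * y) = 2 * (u * v)"
    using assms by (auto simp: conic_def)
  have "2 * x\<^sup>2 = (x\<^sup>2 - d * y\<^sup>2) + (x\<^sup>2 + d * y\<^sup>2)" by simp
  also have "\<dots> = (u\<^sup>2 - d * v\<^sup>2) + (u\<^sup>2 + d * v\<^sup>2)" by (simp only: eq)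
  also have "\<dots> = 2 * u\<^sup>2" by simp
  finally have x2: "x\<^sup>2 = u\<^sup>2" using two_neq_0 by simp
  then have "d * y\<^sup>2 = d * v\<^sup>2" using eq(3) by simp
  then have y2: "y\<^sup>2 = v\<^sup>2" using d_neq_0 by simp
  have xy: "x * y = u * v" using eq(4) two_neq_0 by simp
  from x2 y2 have "u = x \<or> u = - x" "v = y \<or> v = - y" by (auto simp: power2_eq_iff)
  moreover have "x * y = - (x * y) \<Longrightarrow> x = 0 \<or> y = 0"
  proof -
    assume "x * y = - (x * y)"
    then have "2 * (x * y) = 0" unfolding mult_2 by (simp add: eq_neg_iff_add_eq_0)
    then show "x = 0 \<or> y = 0" using two_neq_0 by simp
  qed
  ultimately show ?thesis using xy by auto
qed

lemma card_conic_squares: "card conic \<le> 2 * card (conic_square ` conic)"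
proof -
  let ?fib = "\<lambda>w. {z \<in> conic. conic_square z = w}"
  have fib: "card (?fib w) \<le> 2" for w
  proof (cases "?fib w = {}")
    case False
    then obtain x y where xy: "(x, y) \<in> conic" "conic_square (x, y) = w" by auto
    have "?fib w \<subseteq> {(x, y), (- x, - y)}"
    proof
      fix z assume "z \<in> ?fib w"
      then show "z \<in> {(x, y), (- x, - y)}"
        using conic_square_eqD[OF xy(1), of "fst z" "snd z"] xy(2) by simp
    qed
    then have "card (?fib w) \<le> card {(x, y), (- x, - y)}" by (intro card_mono) auto
    also have "\<dots> \<le> 2" by (simp add: card_insert_if)
    finally show ?thesis .
  next
    case True
    show ?thesis unfolding True by simp
  qed
  have "conic \<subseteq> (\<Union>w\<in>conic_square ` conic. ?fib w)" by blast
  then have "card conic \<le> card (\<Union>w\<in>conic_square ` conic. ?fib w)" by (intro card_mono) auto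
  also have "\<dots> \<le> (\<Sum>w\<in>conic_square ` conic. card (?fib w))" by (rule card_UN_le) simp
  also have "\<dots> \<le> (\<Sum>w\<in>conic_square ` conic. 2)" by (intro sum_mono fib)
  finally show ?thesis by (simp add: mult.commute)
qed

text \<open>
  On the plane a rotation \<open>\<rho>\<close> satisfies \<open>\<rho>\<^sup>2 - 2 x \<rho> + 1 = 0\<close>. For the four values of the trace \<open>2 x\<close>
  in question this is the equation of a root of unity of order \<open>l\<close>. The order does not drop, since
  \<open>\<rho> = -1\<close> if \<open>l = 2\<close> and \<open>y \<noteq> 0\<close> otherwise. The coordinates of the powers are Chebyshev polynomials in \<open>x\<close>; they are written
  in terms of \<open>2 x\<close>, whose value is known.
\<close>

lemma rot_order:
  assumes xy: "(x, y) \<in> conic"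
    and l: "l = 2 \<and> x = -1 \<or> l = 3 \<and> 2 * x = -1 \<and> y \<noteq> 0 \<or> l = 4 \<and> x = 0 \<and> y \<noteq> 0
      \<or> l = 6 \<and> 2 * x = 1 \<and> y \<noteq> 0"
  shows "rot x y ^^ l = id" "\<And>i. 0 < i \<Longrightarrow> i < l \<Longrightarrow> rot x y ^^ i \<noteq> id"
proof -
  have dy: "d * (y * y) = x * x - 1" using xy by (simp add: conic_def power2_eq_square algebra_simps)
  have one: "(1::'a) \<noteq> -1" "(-1::'a) \<noteq> 1" using two_neq_0 by (metis add.right_inverse one_add_one)+
  let ?R = "rot x y"
  have R1: "?R ^^ 1 = rot x y" by simp
  have R2: "?R ^^ 2 = rot (2 * x * x - 1) (2 * x * y)"
  proof -
    have "?R ^^ 2 = ?R \<circ> ?R" by (simp add: numeral_2_eq_2)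
    also have "\<dots> = rot (2 * x * x - 1) (2 * x * y)"
      unfolding rot_comp rot_eq_iff using dy by (simp add: algebra_simps)
    finally show ?thesis .
  qed
  have R3: "?R ^^ 3 = rot ((2 * x) * (2 * x) * x - 3 * x) (((2 * x) * (2 * x) - 1) * y)"
  proof -
    have "?R ^^ 3 = ?R ^^ 1 \<circ> ?R ^^ 2" by (simp add: numeral_3_eq_3 numeral_2_eq_2 comp_assoc)
    also have "\<dots> = rot x y \<circ> rot (2 * x * x - 1) (2 * x * y)" unfolding R1 R2 ..
    also have "\<dots> = rot (x * (2 * x * x - 1) + 2 * x * (d * (y * y))) (x * (2 * x * y) + y * (2 * x * x - 1))"
      unfolding rot_comp rot_eq_iff by (simp add: algebra_simps)
    also have "\<dots> = rot ((2 * x) * (2 * x) * x - 3 * x) (((2 * x) * (2 * x) - 1) * y)"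
      unfolding dy rot_eq_iff by (simp add: algebra_simps)
    finally show ?thesis .
  qed
  have neg: "?R ^^ (3 + n) = rot (-1) 0 \<circ> ?R ^^ n" if "?R ^^ 3 = rot (-1) 0" for n
    unfolding funpow_add that ..
  have neg2: "?R ^^ (2 + n) = rot (-1) 0 \<circ> ?R ^^ n" if "?R ^^ 2 = rot (-1) 0" for n
    unfolding funpow_add that ..
  have "?R ^^ l = id \<and> (\<forall>i. 0 < i \<and> i < l \<longrightarrow> ?R ^^ i \<noteq> id)"
    using l
  proof (elim disjE conjE)
    assume a: "l = 2" "x = -1"
    have "y = 0" using dy a d_neq_0 by simp
    then have "?R ^^ l = id" using a R2 by (simp add: rot_1)
    moreover have "?R ^^ i \<noteq> id" if "0 < i" "i < l" for i
    proof -
      have "i = 1" using that a by simp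
      then show ?thesis using one unfolding rot_1[symmetric] by (simp add: rot_eq_iff a)
    qed
    ultimately show ?thesis by blast
  next
    assume a: "l = 3" "2 * x = -1" "y \<noteq> 0"
    have "(2 * x) * (2 * x) * x - 3 * x = ((2 * x) * (2 * x) - 3) * x"
      by (simp add: algebra_simps)
    also have "\<dots> = (- 2) * x" unfolding a(2) by simp
    also have "\<dots> = - (2 * x)" by simp
    finally have c: "(2 * x) * (2 * x) * x - 3 * x = 1" unfolding a(2) by simp
    have c': "(2 * x) * (2 * x) - 1 = 0" unfolding a(2) by simp
    have "?R ^^ l = id" unfolding a(1) R3 c c' rot_1[symmetric] by simp
    moreover have "?R ^^ i \<noteq> id" if "0 < i" "i < l" for i
    proof -
      have "i = 1 \<or> i = 2" using that a by auto
      then show ?thesis using a unfolding rot_1[symmetric] by (auto simp: R1 R2 rot_eq_iff)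
    qed
    ultimately show ?thesis by blast
  next
    assume a: "l = 4" "x = 0" "y \<noteq> 0"
    have R2': "?R ^^ 2 = rot (-1) 0" using R2 a by simp
    have R4: "?R ^^ 4 = rot 1 0" using neg2[OF R2', of 2] unfolding R2' rot_comp by simp
    have R3': "?R ^^ 3 = rot 0 (- y)" using R3 a by simp
    have "?R ^^ i \<noteq> id" if "0 < i" "i < l" for i
    proof -
      have "i = 1 \<or> i = 2 \<or> i = 3" using that a by auto
      then show ?thesis using a(3) one unfolding rot_1[symmetric] by (auto simp: R1 R2' R3' rot_eq_iff)
    qed
    then show ?thesis using R4 a(1) rot_1 by simp
  next
    assume a: "l = 6" "2 * x = 1" "y \<noteq> 0"
    have "(2 * x) * (2 * x) * x - 3 * x = ((2 * x) * (2 * x) - 3) * x"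
      by (simp add: algebra_simps)
    also have "\<dots> = (- 2) * x" unfolding a(2) by simp
    also have "\<dots> = - (2 * x)" by simp
    finally have c: "(2 * x) * (2 * x) * x - 3 * x = - 1" unfolding a(2) by simp
    have c': "(2 * x) * (2 * x) - 1 = 0" unfolding a(2) by simp
    have R3': "?R ^^ 3 = rot (-1) 0" unfolding R3 c c' by simp
    have R4: "?R ^^ 4 = rot (- x) (- y)" using neg[OF R3', of 1] by (simp add: rot_comp)
    have R5: "?R ^^ 5 = rot (- (2 * x * x - 1)) (- (2 * x * y))"
      using neg[OF R3', of 2] unfolding R2 rot_comp by simp
    have R6: "?R ^^ 6 = rot 1 0"
      using neg[OF R3', of 3] unfolding R3' rot_comp by simp
    have "?R ^^ i \<noteq> id" if "0 < i" "i < l" for i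
    proof -
      have "i = 1 \<or> i = 2 \<or> i = 3 \<or> i = 4 \<or> i = 5" using that a by auto
      then show ?thesis using a(2,3) one unfolding rot_1[symmetric]
        by (auto simp: R1 R2 R3' R4 R5 rot_eq_iff)
    qed
    then show ?thesis using R6 a(1) rot_1 by simp
  qed
  then show "?R ^^ l = id" "\<And>i. 0 < i \<Longrightarrow> i < l \<Longrightarrow> ?R ^^ i \<noteq> id" by auto
qed

lemma card_dihedral:
  assumes xy: "(x, y) \<in> conic"
    and order: "\<And>i. 0 < i \<Longrightarrow> i < l \<Longrightarrow> rot x y ^^ i \<noteq> id"
  shows "card ({rot x y ^^ n | n. n < l} \<union> {rot x y ^^ n \<circ> refl1 | n. n < l}) = 2 * l"
proof -
  have "\<exists>z\<in>conic. rot x y ^^ n = (\<lambda>(x, y). rot x y) z" for n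
  proof (induction n)
    case 0
    have "(1, 0) \<in> conic" by (simp add: conic_def)
    then show ?case using rot_1 by (intro bexI[of _ "(1, 0)"]) (auto simp: id_def)
  next
    case (Suc n)
    then obtain u v where uv: "(u, v) \<in> conic" "rot x y ^^ n = rot u v" by auto
    then have "rot x y ^^ Suc n = rot (x * u + d * y * v) (x * v + y * u)"
      unfolding funpow.simps uv rot_comp by simp
    then show ?case using conic_mult[OF xy uv(1)] by (metis case_prod_conv)
  qed
  then obtain P where P: "\<And>n. P n \<in> conic" "\<And>n. rot x y ^^ n = (\<lambda>(x, y). rot x y) (P n)"
    by metis
  have bij: "bij (rot x y)" using isometries_alongD(1)[OF rot_isometries_along[OF xy]] .
  have neq: "rot x y ^^ m \<noteq> rot x y ^^ n" if mn: "m < n" "n < l" for m n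
  proof
    assume eq: "rot x y ^^ m = rot x y ^^ n"
    have "rot x y ^^ n = rot x y ^^ m \<circ> rot x y ^^ (n - m)"
      using mn by (metis funpow_add le_add_diff_inverse less_imp_le)
    then have "(rot x y ^^ m) ((rot x y ^^ (n - m)) v) = (rot x y ^^ m) v" for v
      using eq by (metis comp_apply)
    moreover have "inj (rot x y ^^ m)" using bij by (simp add: bij_is_inj bij_fn)
    ultimately have "rot x y ^^ (n - m) = id" by (auto simp: inj_def)
    then show False using order[of "n - m"] mn by simp
  qed
  have "inj_on P {..<l}"
  proof (rule inj_onI)
    fix m n assume mn: "m \<in> {..<l}" "n \<in> {..<l}" "P m = P n"
    then have "rot x y ^^ m = rot x y ^^ n" by (simp add: P(2))
    then show "m = n" using neq[of m n] neq[of n m] mn by (metis lessThan_iff linorder_neqE_nat)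
  qed
  then have "card (P ` {..<l}) = l" by (simp add: card_image)
  moreover have "{rot x y ^^ n | n. n < l} = (\<lambda>(x, y). rot x y) ` P ` {..<l}"
    unfolding setcompr_eq_image image_image P(2) lessThan_def ..
  moreover have "{rot x y ^^ n \<circ> refl1 | n. n < l} = (\<lambda>(x, y). rot x y \<circ> refl1) ` P ` {..<l}"
    unfolding setcompr_eq_image image_image P(2) lessThan_def by (simp add: case_prod_beta)
  ultimately show ?thesis
    using card_rotations_reflections[of "P ` {..<l}"] P(1) by auto
qed

end

section \<open>Coordinate subspaces and groups of orthogonal type\<close>

lemma nodes: "(i::4) = 0 \<or> i = 1 \<or> i = 2 \<or> i = 3"
  using exhaust_4[of i] by auto

definition coord_space :: "4 set \<Rightarrow> ('a::field ^ 4) set" where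
  "coord_space I = vec.span ((\<lambda>j. axis j 1) ` I)"

lemma coord_space_iff:
  fixes x :: "'a::field ^ 4"
  shows "x \<in> coord_space I \<longleftrightarrow> (\<forall>j. j \<notin> I \<longrightarrow> x $ j = 0)"
proof
  have "vec.subspace {x :: 'a ^ 4. \<forall>j. j \<notin> I \<longrightarrow> x $ j = 0}"
    by (simp add: vec.subspace_def)
  moreover have "(\<lambda>j. axis j 1) ` I \<subseteq> {x :: 'a ^ 4. \<forall>j. j \<notin> I \<longrightarrow> x $ j = 0}"
    by (auto simp: axis_def)
  ultimately have "coord_space I \<subseteq> {x :: 'a ^ 4. \<forall>j. j \<notin> I \<longrightarrow> x $ j = 0}"
    unfolding coord_space_def by (intro vec.span_minimal)
  then show "x \<in> coord_space I \<Longrightarrow> \<forall>j. j \<notin> I \<longrightarrow> x $ j = 0" by blast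
next
  assume x: "\<forall>j. j \<notin> I \<longrightarrow> x $ j = 0"
  have "x $ j *s axis j 1 \<in> coord_space I" for j
  proof (cases "j \<in> I")
    case True
    then show ?thesis
      unfolding coord_space_def by (intro vec.span_scale vec.span_base) auto
  next
    case False
    then show ?thesis using x by (simp add: coord_space_def vec.span_zero)
  qed
  then have "(\<Sum>j\<in>UNIV. x $ j *s axis j 1) \<in> coord_space I"
    unfolding coord_space_def by (intro vec.span_sum)
  then show "x \<in> coord_space I" by (simp only: basis_expansion)
qed

lemma coord_space_Int: "coord_space I \<inter> coord_space J = coord_space (I \<inter> J)"
  by (auto simp: coord_space_iff)

lemma coord_space_mono: "I \<subseteq> J \<Longrightarrow> coord_space I \<subseteq> coord_space J"
  unfolding coord_space_def by (intro vec.span_mono image_mono)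

lemma subspace_coord_space: "vec.subspace (coord_space I)"
  by (simp add: coord_space_def)

lemma axis_in_coord_space: "i \<in> I \<Longrightarrow> axis i 1 \<in> coord_space I"
  unfolding coord_space_def by (intro vec.span_base) auto

lemma subspace_omit_eq: "subspace_omit J = coord_space (- J)"
  by (simp add: subspace_omit_def coord_space_def)

lemma restrict_eqD: "restrict g W = restrict h W \<Longrightarrow> w \<in> W \<Longrightarrow> g w = h w"
  by (metis restrict_apply')

text \<open>
  Restriction to a nonsingular \<open>W\<close> is injective on isometries with displacements in \<open>W\<close>, so a group
  of these that induces all of the orthogonal group of \<open>W\<close> contains them all.
\<close>

lemma (in symmetric_form) eq_isometries_along_if_acts_as_orth_group:
  assumes W: "vec.subspace W" "nonsingular f W" and H: "H \<subseteq> isometries_along W"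
    and full: "acting_on H W = orth_group f W"
  shows "H = isometries_along W"
proof
  show "isometries_along W \<subseteq> H"
  proof
    fix g assume g: "g \<in> isometries_along W"
    have "restrict g W \<in> acting_on H W"
      using restrict_isometries_along[OF W(1) g] full by simp
    then obtain h where h: "h \<in> H" "restrict g W = restrict h W"
      unfolding acting_on_def by blast
    have "g = h"
      using restrict_eqD[OF h(2)] H h(1) by (intro isometries_along_eqI[OF W g]) auto
    then show "g \<in> H" using h by simp
  qed
qed (rule H)

lemma (in symmetric_form) refl_mem_if_acts:
  assumes W: "vec.subspace W" "nonsingular f W" and H: "H \<subseteq> isometries_along W"
    and a: "a \<in> W" "f a a \<noteq> 0" and acts: "restrict (refl f a) W \<in> acting_on H W"
  shows "refl f a \<in> H"
proof -
  obtain h where h: "h \<in> H" "restrict (refl f a) W = restrict h W"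
    using acts unfolding acting_on_def by blast
  have "refl f a = h"
    using restrict_eqD[OF h(2)] H h(1)
    by (intro isometries_along_eqI[OF W refl_isometries_along[OF W(1) a]]) auto
  then show ?thesis using h by simp
qed

text \<open>
  The constant \<open>c\<close> represents a class of norms, the squares or the nonsquares, such that the group
  induced on \<open>W\<close> contains the reflections along all roots with norms in this class.
\<close>

lemma orthogonal_type_reflections:
  fixes f :: "'p::prime_card mod_ring ^ 'n \<Rightarrow> 'p mod_ring ^ 'n \<Rightarrow> 'p mod_ring"
  assumes form: "symmetric_form f"
    and W: "vec.subspace W" "nonsingular f W" and H: "H \<subseteq> symmetric_form.isometries_along f W"
    and type: "orthogonal_type f W (acting_on H W)"
  shows "\<exists>c. c \<noteq> 0 \<and> (\<forall>a\<in>W. f a a = c \<longrightarrow> refl f a \<in> H)"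
proof -
  interpret symmetric_form f by (rule form)
  have reduce: ?thesis
    if "c \<noteq> 0" "\<And>a. a \<in> W \<Longrightarrow> f a a = c \<Longrightarrow> restrict (refl f a) W \<in> acting_on H W" for c
    using that refl_mem_if_acts[OF W H] by metis
  consider "acting_on H W = orth_group f W" | "acting_on H W = orth_group1 f W"
    | "acting_on H W = orth_group2 f W"
    using type unfolding orthogonal_type_def by blast
  then show ?thesis
  proof cases
    case 1
    show ?thesis
    proof (rule reduce[of 1])
      fix a assume "a \<in> W" "f a a = 1"
      then show "restrict (refl f a) W \<in> acting_on H W"
        unfolding 1 by (intro restrict_isometries_along refl_isometries_along W) auto
    qed simp
  next
    case 2
    have "nonzero_square (1 :: 'p mod_ring)"
      unfolding nonzero_square_def by (metis one_neq_zero one_power2)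
    then show ?thesis
      unfolding orth_group1_def 2
      by (intro reduce[of 1]) (auto simp: 2 orth_group1_def intro!: generate.incl)
  next
    case 3
    obtain c :: "'p mod_ring" where c: "nonsquare c"
      using exists_nonsquare[OF two_neq_0] by blast
    have "c \<noteq> 0" using c unfolding nonsquare_def by (metis zero_power2)
    then show ?thesis
      using c by (intro reduce[of c]) (auto simp: 3 orth_group2_def intro!: generate.incl)
  qed
qed

section \<open>The reduced basic system and its generators\<close>

lemma red_half: "2 * x = of_int n \<Longrightarrow> red x = (of_int n / 2 :: 'p::prime_card mod_ring)"
  unfolding red_def by simp

lemma red_of_int:
  assumes "(2 :: 'p::prime_card mod_ring) \<noteq> 0"
  shows "red (of_int n) = (of_int n :: 'p mod_ring)"
  using assms by (subst red_half[of _ "2 * n"]) auto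

text \<open>
  Four times the squared cosine is an integer for the crystallographic marks, and so survives
  reduction modulo a prime.
\<close>

lemma cos_mark_square:
  assumes "q \<in> {2, 3, 4, 6, \<infinity>}"
  shows "4 * (cos_mark q)\<^sup>2 = (if q = 2 then 0 else if q = 3 then 1 else if q = 4 then 2
    else if q = 6 then 3 else 4)"
proof -
  have "cos_mark 2 = 0" "cos_mark 3 = 1 / 2" "cos_mark 4 = sqrt 2 / 2" "cos_mark 6 = sqrt 3 / 2"
    "cos_mark \<infinity> = 1"
    by (simp_all add: cos_mark_def numeral_eq_enat cos_60 cos_45 cos_30)
  note vals = this
  show ?thesis using assms by (auto simp: vals power_divide)
qed

lemma red_form_axis:
  "red_form B b (axis i 1) (axis j (1 :: 'p::prime_card mod_ring)) = red (B (b i) (b j))"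
proof -
  have "axis i (1 :: 'p mod_ring) $ s * red (B (b s) (b t)) * axis j 1 $ t
      = (if t = j then (if s = i then red (B (b i) (b j)) else 0) else 0)" for s t
    by (auto simp: axis_def)
  then show ?thesis unfolding red_form_def by simp
qed

lemma red_form_axis_right:
  fixes x :: "'p::prime_card mod_ring ^ 4"
  shows "red_form B b x (axis j 1) = (\<Sum>i\<in>UNIV. x $ i * red (B (b i) (b j)))"
proof -
  have "x $ s * red (B (b s) (b t)) * axis j (1 :: 'p mod_ring) $ t
      = (if t = j then x $ s * red (B (b s) (b j)) else 0)" for s t
    by (auto simp: axis_def)
  then show ?thesis unfolding red_form_def by simp
qed

locale reduced_basic_system =
  fixes k l m :: enat
    and B :: "real ^ 4 \<Rightarrow> real ^ 4 \<Rightarrow> real"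
    and b :: "4 \<Rightarrow> real ^ 4"
    and f :: "'p::prime_card mod_ring ^ 4 \<Rightarrow> 'p mod_ring ^ 4 \<Rightarrow> 'p mod_ring"
    and r :: "4 \<Rightarrow> 'p mod_ring ^ 4 \<Rightarrow> 'p mod_ring ^ 4"
  assumes basic: "basic_system k l m B b"
    and f_def: "f = red_form B b"
    and r_def: "r = red_refl B b"
    and generic: "generic_prime CARD('p) k l m"
begin

lemma basicD:
  "{k, l, m} \<subseteq> {2, 3, 4, 6, \<infinity>}" "\<forall>x y. B x y = B y x"
  "inj b" "independent (range b)" "span (range b) = UNIV"
  "\<forall>i j. i \<noteq> j \<longrightarrow>
     B (b i) (b j) = - cos_mark (mark k l m i j) * sqrt (B (b i) (b i) * B (b j) (b j))"
  "\<forall>i j. 2 * B (b i) (b j) / B (b i) (b i) \<in> \<int>"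
  "\<forall>i. \<exists>a::nat. B (b i) (b i) = real a \<and> a > 0 \<and>
     (\<forall>q. prime q \<and> q dvd a \<longrightarrow> q = 2 \<or> q = 3) \<and>
     ((\<forall>j j'. (i, j) \<in> (diagram_edges k l m)\<^sup>* \<longrightarrow> mark k l m j j' \<noteq> 6) \<longrightarrow> \<not> 3 dvd a)"
  by (insert basic, unfold basic_system_def) (elim conjE, assumption)+

lemma B_sym: "B x y = B y x"
  using basicD(2) by (elim allE)

lemma of_nat_neq_0:
  assumes "0 < n" "\<And>q. prime q \<Longrightarrow> q dvd n \<Longrightarrow> q \<noteq> CARD('p)"
  shows "(of_nat n :: 'p mod_ring) \<noteq> 0"
  using assms(2) of_nat_0_mod_ring_dvd[of n, where 'a = 'p] prime_card[where 'a = 'p] by blast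

lemma card_ge_3: "CARD('p) \<ge> 3"
  using generic unfolding generic_prime_def by auto

lemma two_neq_0: "(2 :: 'p mod_ring) \<noteq> 0"
proof
  assume "(2 :: 'p mod_ring) = 0"
  then have "CARD('p) dvd 2" using of_nat_0_mod_ring_dvd[of 2, where 'a = 'p] by simp
  then have "CARD('p) \<le> 2" by (rule dvd_imp_le) simp
  then show False using card_ge_3 by simp
qed

text \<open>
  A label has no prime divisors except 2 and 3, and if the generic prime is 3, then no branch is
  marked 6, so that 3 divides no label.
\<close>

lemma label_invertible:
  obtains a where "B (b i) (b i) = real a" "a > 0" "(of_nat a :: 'p mod_ring) \<noteq> 0"
proof -
  obtain a where a: "B (b i) (b i) = real a" "a > 0"
    "\<forall>q. prime q \<and> q dvd a \<longrightarrow> q = 2 \<or> q = 3"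
    "(\<forall>j j'. (i, j) \<in> (diagram_edges k l m)\<^sup>* \<longrightarrow> mark k l m j j' \<noteq> 6) \<longrightarrow> \<not> 3 dvd a"
    using basicD(8)[rule_format, of i] by (elim exE conjE)
  have "q \<noteq> CARD('p)" if q: "prime q" "q dvd a" for q
  proof
    assume qp: "q = CARD('p)"
    then have q3: "q = 3" using a(3)[rule_format, OF conjI[OF q]] card_ge_3 by linarith
    then have "6 \<notin> {k, l, m}" using generic qp unfolding generic_prime_def by auto
    then have "mark k l m j j' \<noteq> 6" for j j' by (auto simp: mark_def)
    then show False using a(4) q q3 by blast
  qed
  then have "(of_nat a :: 'p mod_ring) \<noteq> 0" by (intro of_nat_neq_0 a(2)) auto
  then show thesis using that a by blast
qed

lemma cartan_integer: "\<exists>n::int. 2 * B (b j) (b i) = of_int n * B (b i) (b i)"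
proof -
  obtain a where a: "B (b i) (b i) = real a" "a > 0" by (rule label_invertible)
  have "2 * B (b i) (b j) / B (b i) (b i) \<in> \<int>"
    using basicD(7) by (elim allE)
  then obtain n where "2 * B (b i) (b j) / B (b i) (b i) = of_int n" by (auto elim: Ints_cases)
  then have "2 * B (b j) (b i) = of_int n * B (b i) (b i)"
    using a(2) unfolding B_sym[of "b i" "b j"] a(1) by (simp add: field_simps)
  then show ?thesis by blast
qed

lemma two_B_integer: "\<exists>n::int. 2 * B (b i) (b j) = of_int n"
proof -
  obtain a where a: "B (b j) (b j) = real a" by (rule label_invertible)
  obtain n :: int where "2 * B (b i) (b j) = of_int n * B (b j) (b j)" using cartan_integer by blast
  then have "2 * B (b i) (b j) = of_int (n * int a)" by (simp add: a)
  then show ?thesis by blast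
qed

lemma f_axis: "f (axis i 1) (axis j 1) = red (B (b i) (b j))"
  unfolding f_def by (rule red_form_axis)

lemma f_axis_neq_0: "f (axis i 1) (axis i 1) \<noteq> 0"
proof -
  obtain a where a: "B (b i) (b i) = real a" "(of_nat a :: 'p mod_ring) \<noteq> 0" by (rule label_invertible)
  then show ?thesis
    using red_of_int[OF two_neq_0, of "int a"] by (simp add: f_axis)
qed

sublocale symmetric_form f
proof
  show "f (x + y) z = f x z + f y z" for x y z
    by (simp add: f_def red_form_def algebra_simps sum.distrib)
  show "f (c *s x) y = c * f x y" for c x y
    by (simp add: f_def red_form_def sum_distrib_left mult.assoc)
  show "f x y = f y x" for x y
    unfolding f_def red_form_def
    by (subst sum.swap) (simp add: B_sym[of "b _" "b _"] mult.commute mult.left_commute mult.assoc)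
  show "(2::'p mod_ring) \<noteq> 0" by (rule two_neq_0)
qed

lemma basis_matrix_refl:
  "basis_matrix b (refl B (b i)) $ s $ t =
    (if s = t then 1 else 0) - (if s = i then 2 * B (b t) (b i) / B (b i) (b i) else 0)"
proof -
  have ind: "independent (range b)" and sp: "span (range b) = UNIV" and inj: "inj b"
    by (fact basicD)+
  have rep: "representation (range b) (b j) (b s) = (if s = j then 1 else 0)" for j
    using real_vector.representation_basis[OF ind, of "b j"] inj by (auto simp: inj_def)
  have "representation (range b) (b t - c *\<^sub>R b i) (b s)
      = representation (range b) (b t) (b s) - c * representation (range b) (b i) (b s)" for c
    using ind sp by (simp add: real_vector.representation_diff real_vector.representation_scale)
  then show ?thesis
    by (simp add: basis_matrix_def refl_def scalar_mult_eq_scaleR rep)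
qed

text \<open>
  Reduction commutes with forming reflections because the entries of the reflection matrices
  are integers and the denominators \<open>B (b i) (b i)\<close> of the Cartan integers remain invertible.
\<close>

lemma r_eq_refl: "r i = refl f (axis i 1)"
proof
  fix x :: "'p mod_ring ^ 4"
  have "\<forall>t. \<exists>n::int. 2 * B (b t) (b i) = of_int n * B (b i) (b i)"
    using cartan_integer by blast
  then obtain n :: "4 \<Rightarrow> int" where n: "\<And>t. 2 * B (b t) (b i) = of_int (n t) * B (b i) (b i)"
    by metis
  obtain a where a: "B (b i) (b i) = real a" "a > 0" "(of_nat a :: 'p mod_ring) \<noteq> 0" by (rule label_invertible)
  have fii: "f (axis i 1) (axis i 1) = of_nat a"
    using red_of_int[OF two_neq_0, of "int a"] by (simp add: f_axis a)
  have rti: "2 * red (B (b t) (b i)) = (of_int (n t) * of_nat a :: 'p mod_ring)" for t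
  proof -
    have "2 * B (b t) (b i) = of_int (n t * int a)" using n[of t] by (simp add: a)
    then show ?thesis unfolding red_half[OF \<open>2 * B (b t) (b i) = of_int (n t * int a)\<close>]
      using two_neq_0 by simp
  qed
  have "2 * f x (axis i 1) = (\<Sum>t\<in>UNIV. x $ t * (2 * red (B (b t) (b i))))"
    unfolding f_def red_form_axis_right by (simp add: sum_distrib_left mult.left_commute)
  also have "\<dots> = (\<Sum>t\<in>UNIV. of_int (n t) * x $ t) * of_nat a"
    unfolding rti by (simp add: sum_distrib_left mult.commute mult.left_commute)
  finally have c: "2 * f x (axis i 1) / f (axis i 1) (axis i 1) = (\<Sum>t\<in>UNIV. of_int (n t) * x $ t)"
    using a(3) by (simp add: fii)
  have "basis_matrix b (refl B (b i)) $ s $ t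
      = of_int ((if s = t then 1 else 0) - (if s = i then n t else 0))" for s t
    using a n[of t] by (simp add: basis_matrix_refl)
  then have mat: "red (basis_matrix b (refl B (b i)) $ s $ t)
      = (of_int ((if s = t then 1 else 0) - (if s = i then n t else 0)) :: 'p mod_ring)" for s t
    by (simp only: red_of_int[OF two_neq_0])
  have "r i x $ s = refl f (axis i 1) x $ s" for s
  proof -
    have "r i x $ s = (\<Sum>t\<in>UNIV. of_int ((if s = t then 1 else 0) - (if s = i then n t else 0)) * x $ t)"
      unfolding r_def red_refl_def matrix_vector_mult_def by (simp add: mat)
    also have "\<dots> = (\<Sum>t\<in>UNIV. (if s = t then x $ t else 0) - (if s = i then of_int (n t) * x $ t else 0))"
      by (intro sum.cong) (auto simp: algebra_simps)
    also have "\<dots> = x $ s - (if s = i then (\<Sum>t\<in>UNIV. of_int (n t) * x $ t) else 0)"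
      by (simp add: sum_subtractf)
    also have "\<dots> = refl f (axis i 1) x $ s"
      unfolding refl_def c by (simp add: axis_def)
    finally show ?thesis .
  qed
  then show "r i x = refl f (axis i 1) x" by (simp add: vec_eq_iff)
qed

sublocale involutions r
  by standard (auto simp: r_eq_refl refl_invol[OF f_axis_neq_0])

lemma subgroup_on_isometries: "subgroup_on r I \<subseteq> isometries_along (coord_space I)"
proof
  fix g assume "g \<in> subgroup_on r I"
  then show "g \<in> isometries_along (coord_space I)"
  proof (induction rule: subgroup_on_induct)
    case id
    show ?case by (rule id_isometries_along[OF subspace_coord_space])
  next
    case (step i h)
    then show ?case
      unfolding r_eq_refl
      by (intro isometries_along_comp refl_isometries_along subspace_coord_space
          axis_in_coord_space f_axis_neq_0)
  qed
qed

lemma r_commute: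
  assumes "mark k l m i j = 2" "i \<noteq> j"
  shows "r i \<circ> r j = r j \<circ> r i"
proof -
  have "B (b i) (b j) = 0"
    using basicD(6)[rule_format, OF assms(2)] assms(1) by (simp add: cos_mark_def numeral_eq_enat)
  then have 0: "f (axis i 1) (axis j 1) = 0" "f (axis j 1) (axis i 1) = 0"
    using red_of_int[OF two_neq_0, of 0] sym by (auto simp: f_axis)
  show ?thesis
    unfolding r_eq_refl by (auto simp: refl_def form_simps 0)
qed

lemma r_commute_branches:
  "r 0 \<circ> r 2 = r 2 \<circ> r 0" "r 0 \<circ> r 3 = r 3 \<circ> r 0" "r 1 \<circ> r 3 = r 3 \<circ> r 1"
  "r 2 \<circ> r 0 = r 0 \<circ> r 2" "r 3 \<circ> r 0 = r 0 \<circ> r 3" "r 3 \<circ> r 1 = r 1 \<circ> r 3"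
  by (intro r_commute; simp add: mark_def doubleton_eq_iff)+

section \<open>The intersection property\<close>

text \<open>
  An element of two of the groups displaces vectors only along the roots that belong to both,
  and along a single root there is only one reflection.
\<close>

lemma subgroup_on_Int_small:
  assumes "card (I \<inter> J) \<le> 1"
  shows "subgroup_on r I \<inter> subgroup_on r J \<subseteq> subgroup_on r (I \<inter> J)"
proof
  fix g assume "g \<in> subgroup_on r I \<inter> subgroup_on r J"
  then have "g \<in> isometries_along (coord_space I) \<inter> isometries_along (coord_space J)"
    by (intro IntI subsetD[OF subgroup_on_isometries]) auto
  then have g: "g \<in> isometries_along (coord_space (I \<inter> J))"
    by (simp only: isometries_along_Int coord_space_Int)
  have "I \<inter> J = {} \<or> (\<exists>i. I \<inter> J = {i})"
    using assms by (metis card_0_eq card_1_singletonE finite less_one linorder_le_less_linear nle_le)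
  then show "g \<in> subgroup_on r (I \<inter> J)"
  proof (elim disjE exE)
    assume "I \<inter> J = {}"
    then have "g x - x \<in> {0}" for x
      using isometries_alongD(5)[OF g, of x] by (simp add: coord_space_def)
    then have "g = id" by auto
    then show ?thesis using subgroup_on_id by simp
  next
    fix i assume i: "I \<inter> J = {i}"
    then have "g = id \<or> g = r i"
      using isometries_along_line[OF f_axis_neq_0, of g i] g by (simp add: coord_space_def r_eq_refl)
    then show ?thesis using subgroup_on_id subgroup_on_r i by auto
  qed
qed

text \<open>
  A common element \<open>h \<circ> h'\<close> has its factor \<open>h\<close> in the second group, hence also its factor \<open>h'\<close>,
  and \<open>h'\<close> is controlled by the case of at most one common generator.
\<close>

lemma subgroup_on_Int_commuting:
  assumes comm: "\<And>i j. i \<in> I \<Longrightarrow> j \<in> I' \<Longrightarrow> r i \<circ> r j = r j \<circ> r i"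
    and sub: "I \<subseteq> J" and small: "card (I' \<inter> J) \<le> 1"
  shows "subgroup_on r (I \<union> I') \<inter> subgroup_on r J \<subseteq> subgroup_on r ((I \<union> I') \<inter> J)"
proof
  fix g assume g: "g \<in> subgroup_on r (I \<union> I') \<inter> subgroup_on r J"
  obtain h h' where h: "h \<in> subgroup_on r I" "h' \<in> subgroup_on r I'" "g = h \<circ> h'"
    by (rule subgroup_on_commuting_Un[of I I' g, OF comm]) (use g in auto)
  have "h \<in> subgroup_on r J" using h(1) subgroup_on_mono[OF sub] by (rule subsetD[rotated])
  then have "h' \<in> subgroup_on r J"
    by (rule subgroup_on_cancel) (use h g bij_subgroup_on[OF h(2)] in auto)
  then have "h' \<in> subgroup_on r (I' \<inter> J)"
    using subgroup_on_Int_small[OF small] h(2) by blast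
  moreover have "I \<subseteq> (I \<union> I') \<inter> J" "I' \<inter> J \<subseteq> (I \<union> I') \<inter> J" using sub by auto
  ultimately show "g \<in> subgroup_on r ((I \<union> I') \<inter> J)"
    unfolding h(3) using h(1) by (intro subgroup_on_comp) (blast dest: subgroup_on_mono)+
qed

text \<open>
  Two incomparable sets of nodes with at least two common elements are the complements of single
  nodes. If one of the omitted nodes is an inner one, omitting it splits the diagram into two
  commuting parts: one of these is contained in the other set, and the remaining one shares at most
  one node with it. This leaves the pair of end nodes.
\<close>

lemma C_group_iff:
  "C_group r \<longleftrightarrow> subgroup_on r (- {0}) \<inter> subgroup_on r (- {3}) \<subseteq> subgroup_on r {1, 2}"
proof
  have 12: "- {0} \<inter> - {3::4} = {1, 2}" using nodes by auto
  show "C_group r \<Longrightarrow> subgroup_on r (- {0}) \<inter> subgroup_on r (- {3}) \<subseteq> subgroup_on r {1, 2}"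
    unfolding C_group_def by (metis 12 order_refl)
  assume main: "subgroup_on r (- {0}) \<inter> subgroup_on r (- {3}) \<subseteq> subgroup_on r {1, 2}"
  let ?P = "\<lambda>I J. subgroup_on r I \<inter> subgroup_on r J \<subseteq> subgroup_on r (I \<inter> J)"
  have P_sym: "?P I J \<Longrightarrow> ?P J I" for I J by (simp add: Int_commute)
  have 1: "- {1::4} = {0} \<union> {2, 3}" "- {1::4} = {2, 3} \<union> {0}"
    and 2: "- {2::4} = {3} \<union> {0, 1}" "- {2::4} = {0, 1} \<union> {3}"
    using nodes by auto
  have small: "card (A \<inter> C) \<le> 1" if "A \<inter> C \<subseteq> {c}" for A C :: "4 set" and c
    using card_mono[OF _ that] by simp
  note commute = r_commute_branches
  have P10: "?P (- {1}) (- {0})"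
    unfolding 1(2) by (rule subgroup_on_Int_commuting) (use commute in \<open>auto intro: small[of _ _ 0]\<close>)
  have P12: "?P (- {1}) (- {2})"
    unfolding 1(1) by (rule subgroup_on_Int_commuting) (use commute in \<open>auto intro: small[of _ _ 3]\<close>)
  have P13: "?P (- {1}) (- {3})"
    unfolding 1(1) by (rule subgroup_on_Int_commuting) (use commute in \<open>auto intro: small[of _ _ 2]\<close>)
  have P20: "?P (- {2}) (- {0})"
    unfolding 2(1) by (rule subgroup_on_Int_commuting) (use commute in \<open>auto intro: small[of _ _ 1]\<close>)
  have P23: "?P (- {2}) (- {3})"
    unfolding 2(2) by (rule subgroup_on_Int_commuting) (use commute in \<open>auto intro: small[of _ _ 3]\<close>)
  have P0: "?P (- {0}) (- {3})" using main unfolding 12 .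
  have two: "?P (- {a}) (- {c})" if "a \<noteq> c" for a c
    using nodes[of a] nodes[of c] that
      P0 P10 P12 P13 P20 P23 P0[THEN P_sym] P10[THEN P_sym] P12[THEN P_sym] P13[THEN P_sym]
      P20[THEN P_sym] P23[THEN P_sym]
    by (elim disjE) (simp_all only: refl not_True_eq_False simp_thms)
  have "?P I J" for I J
  proof (cases "I \<subseteq> J \<or> J \<subseteq> I \<or> card (I \<inter> J) \<le> 1")
    case True
    then show ?thesis
      using subgroup_on_Int_small by (metis Int_lower1 Int_lower2 inf.absorb1 inf.absorb2)
  next
    case False
    then obtain a c where ac: "a \<in> I" "a \<notin> J" "c \<in> J" "c \<notin> I" by blast
    then have neq: "a \<noteq> c" by blast
    have sub: "I \<inter> J \<subseteq> - {a, c}" using ac by blast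
    have "card (- {a, c}) = 2"
      using neq by (simp add: Compl_eq_Diff_UNIV card_Diff_subset)
    then have IJ: "I \<inter> J = - {a, c}"
      using False by (intro card_seteq[OF _ sub]) auto
    have "I = - {c}" "J = - {a}" using IJ ac by auto
    then show ?thesis using two[of c a] neq by simp
  qed
  then show "C_group r"
    unfolding C_group_def by (intro allI equalityI Int_greatest subgroup_on_mono) auto
qed

end

section \<open>The plane at the two middle nodes\<close>

text \<open>
  The root at node 1 and the component perpendicular to it of the root at node 2 form the
  orthogonal basis of the plane; \<open>slope\<close> is the coordinate of the latter root along the former.
\<close>

locale nonsingular_middle = reduced_basic_system k l m B b f r
  for k l m B b
    and f :: "'p::prime_card mod_ring ^ 4 \<Rightarrow> 'p mod_ring ^ 4 \<Rightarrow> 'p mod_ring"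
    and r :: "4 \<Rightarrow> 'p mod_ring ^ 4 \<Rightarrow> 'p mod_ring ^ 4" +
  assumes nonsing: "nonsingular f (coord_space {1, 2})"
begin

definition slope :: "'p mod_ring" where
  "slope = f (axis 1 1) (axis 2 1) / f (axis 1 1) (axis 1 1)"

definition length_ratio :: "'p mod_ring" where
  "length_ratio = f (axis 2 1) (axis 2 1) / f (axis 1 1) (axis 1 1)"

definition perp :: "'p mod_ring ^ 4" where
  "perp = axis 2 1 - slope *s axis 1 1"

lemma length_ratio_neq_0: "length_ratio \<noteq> 0"
  using f_axis_neq_0 by (simp add: length_ratio_def)

lemma f_perp: "f (axis 1 1) perp = 0"
    "f perp perp = - (slope\<^sup>2 - length_ratio) * f (axis 1 1) (axis 1 1)"
proof -
  have s: "f (axis 1 1) (axis 2 1) = slope * f (axis 1 1) (axis 1 1)"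
    and q: "f (axis 2 1) (axis 2 1) = length_ratio * f (axis 1 1) (axis 1 1)"
    using f_axis_neq_0 by (simp_all add: slope_def length_ratio_def)
  show "f (axis 1 1) perp = 0"
    unfolding perp_def diff_right scale_right s by simp
  show "f perp perp = - (slope\<^sup>2 - length_ratio) * f (axis 1 1) (axis 1 1)"
    unfolding perp_def diff_right diff_left scale_right scale_left sym[of "axis 2 1" "axis 1 1"] s q
    by (simp add: power2_eq_square algebra_simps)
qed

text \<open>
  If the discriminant vanished, \<open>perp\<close> would be orthogonal to both roots, so to the whole plane.
\<close>

lemma discriminant_neq_0: "slope\<^sup>2 - length_ratio \<noteq> 0"
proof
  assume 0: "slope\<^sup>2 - length_ratio = 0"
  have in12: "axis i 1 \<in> coord_space {1, 2}" if "i \<in> {1, 2}" for i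
    using that by (rule axis_in_coord_space)
  have perp_in: "perp \<in> coord_space {1, 2}"
    unfolding perp_def
    by (intro vec.subspace_diff vec.subspace_scale subspace_coord_space in12) auto
  have fp: "f perp (axis 1 1) = 0" "f perp perp = 0"
    using f_perp sym[of perp "axis 1 1"] 0 by simp_all
  have "f perp (axis 2 1) = f perp (perp + slope *s axis 1 1)"
    by (simp add: perp_def)
  then have fp2: "f perp (axis 2 1) = 0"
    by (simp only: add_right scale_right fp mult_zero_right add_0)
  have "f perp w = 0" if w: "w \<in> coord_space {1, 2}" for w
  proof -
    have "vec.subspace {w. f perp w = 0}"
      by (simp add: vec.subspace_def form_simps)
    moreover have "(\<lambda>j. axis j 1) ` {1, 2} \<subseteq> {w. f perp w = 0}" using fp(1) fp2 by auto
    ultimately have "coord_space {1, 2} \<subseteq> {w. f perp w = 0}"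
      unfolding coord_space_def by (intro vec.span_minimal)
    then show ?thesis using w by blast
  qed
  then have "perp \<in> coord_space {1, 2} \<inter> {x. \<forall>y\<in>coord_space {1, 2}. f x y = 0}"
    using perp_in by simp
  then have "perp = 0" using nonsing unfolding nonsingular_def by simp
  then have "perp $ 2 = 0" by simp
  then show False by (simp add: perp_def axis_def)
qed

sublocale orthogonal_plane f "axis 1 1" perp "slope\<^sup>2 - length_ratio"
  by standard (use f_axis_neq_0 f_perp discriminant_neq_0 in auto)

lemma axis_2_eq_pt: "axis 2 1 = pt slope 1"
  unfolding pt_def by (simp add: perp_def)

lemma plane_eq_coord_space: "plane = coord_space {1, 2}"
proof (rule antisym)
  have in12: "axis i 1 \<in> coord_space {1, 2}" if "i \<in> {1, 2}" for i
    using that by (rule axis_in_coord_space)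
  have "perp \<in> coord_space {1, 2}"
    unfolding perp_def
    by (intro vec.subspace_diff vec.subspace_scale subspace_coord_space in12) auto
  then show "plane \<subseteq> coord_space {1, 2}"
    unfolding plane_def using in12 by (intro vec.span_minimal subspace_coord_space) auto
  show "coord_space {1, 2} \<subseteq> plane"
  proof -
    have "axis 1 1 \<in> plane" "axis 2 1 \<in> plane"
      using pt_in_plane[of 1 0] pt_in_plane[of slope 1] unfolding pt_linear(3) axis_2_eq_pt by blast+
    then show ?thesis
      unfolding coord_space_def by (intro vec.span_minimal subspace_plane) auto
  qed
qed

text \<open>
  This is the relation \<open>4 (B (b 1) (b 2))\<^sup>2 = 4 cos\<^sup>2 (\<pi> / l) B (b 1) (b 1) B (b 2) (b 2)\<close> between
  integers, reduced modulo the prime and divided by the square of the first label.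
\<close>

lemma slope_length_ratio:
  assumes c: "4 * (cos_mark l)\<^sup>2 = real c"
  shows "4 * slope\<^sup>2 = of_nat c * length_ratio"
proof -
  obtain a1 where a1: "B (b 1) (b 1) = real a1" by (rule label_invertible)
  obtain a2 where a2: "B (b 2) (b 2) = real a2" by (rule label_invertible)
  obtain n where n: "2 * B (b 1) (b 2) = of_int n" using two_B_integer by blast
  have "mark k l m 1 2 = l" by (simp add: mark_def doubleton_eq_iff)
  then have "B (b 1) (b 2) = - cos_mark l * sqrt (real a1 * real a2)"
    using basicD(6)[rule_format, of 1 2] by (simp add: a1 a2)
  then have "(2 * B (b 1) (b 2))\<^sup>2 = 4 * (cos_mark l)\<^sup>2 * (real a1 * real a2)"
    by (simp add: power_mult_distrib)
  then have "real_of_int (n\<^sup>2) = real_of_int (int c * int a1 * int a2)"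
    unfolding n c by simp
  then have "n\<^sup>2 = int c * int a1 * int a2" by (simp only: of_int_eq_iff)
  then have "(of_int (n\<^sup>2) :: 'p mod_ring) = of_int (int c * int a1 * int a2)" by simp
  then have nn: "(of_int n)\<^sup>2 = (of_nat c * of_nat a1 * of_nat a2 :: 'p mod_ring)" by simp
  have f11: "f (axis 1 1) (axis 1 1) = of_nat a1" and f22: "f (axis 2 1) (axis 2 1) = of_nat a2"
    using red_of_int[OF two_neq_0, of "int a1"] red_of_int[OF two_neq_0, of "int a2"]
    by (simp_all add: f_axis a1 a2)
  have "2 * f (axis 1 1) (axis 2 1) = of_int n"
    unfolding f_axis red_half[OF n] using two_neq_0 by simp
  then have f12: "2 * slope = of_int n / of_nat a1"
    unfolding slope_def f11 by (metis times_divide_eq_right)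
  have a10: "(of_nat a1 :: 'p mod_ring) \<noteq> 0" using f_axis_neq_0[of 1] f11 by simp
  have "4 * slope\<^sup>2 = (2 * slope)\<^sup>2" by (simp add: power_mult_distrib)
  also have "\<dots> = of_nat c * (of_nat a2 / of_nat a1)"
    unfolding f12 power_divide nn using a10 by (simp add: power2_eq_square)
  finally show ?thesis unfolding length_ratio_def f11 f22 .
qed

text \<open>
  The product of the two middle generators is a rotation with trace \<open>2 cos (2 \<pi> / l)\<close>, which is
  \<open>c - 2\<close> for the integer \<open>c = 4 cos\<^sup>2 (\<pi> / l)\<close>. Its order is therefore \<open>l\<close>. The value \<open>c = 4\<close>, that is
  an infinite mark, would make the plane singular.
\<close>

lemma dihedral_group:
  "subgroup_on r {1, 2} \<subseteq> isometries_along plane"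
  "card (subgroup_on r {1, 2}) = 2 * the_enat l"
proof -
  show "subgroup_on r {1, 2} \<subseteq> isometries_along plane"
    unfolding plane_eq_coord_space by (rule subgroup_on_isometries)
  let ?d = "slope\<^sup>2 - length_ratio"
  let ?x = "(slope\<^sup>2 + ?d * 1\<^sup>2) / (slope\<^sup>2 - ?d * 1\<^sup>2)"
    and ?y = "2 * slope * 1 / (slope\<^sup>2 - ?d * 1\<^sup>2)"
  have n: "slope\<^sup>2 - ?d * 1\<^sup>2 = length_ratio" by simp
  then have n0: "slope\<^sup>2 - ?d * 1\<^sup>2 \<noteq> 0" using length_ratio_neq_0 by simp
  have xy: "(?x, ?y) \<in> conic" and r2: "refl f (pt slope 1) = rot ?x ?y \<circ> refl1"
    using refl_eq_rot[OF n0] by blast+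
  have rho: "rot ?x ?y = r 2 \<circ> r 1"
    unfolding r_eq_refl axis_2_eq_pt r2 comp_assoc refl1_invol by simp
  define c :: nat where "c = (if l = 2 then 0 else if l = 3 then 1 else if l = 4 then 2
    else if l = 6 then 3 else 4)"
  have l: "l \<in> {2, 3, 4, 6, \<infinity>}" using basicD(1) by blast
  have s: "4 * slope\<^sup>2 = of_nat c * length_ratio"
    using cos_mark_square[OF l] by (intro slope_length_ratio) (simp add: c_def)
  have four: "(4 :: 'p mod_ring) \<noteq> 0"
  proof -
    have "(4 :: 'p mod_ring) = 2 * 2" by simp
    then show ?thesis using two_neq_0 by (metis mult_eq_0_iff)
  qed
  have "c \<noteq> 4"
  proof
    assume "c = 4"
    then have "4 * ?d = 0" using s by (simp add: algebra_simps)
    then show False using discriminant_neq_0 four by simp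
  qed
  then have l: "l \<in> {2, 3, 4, 6}" using l unfolding c_def by (auto split: if_splits)
  have "2 * (2 * ?x) = (4 * slope\<^sup>2 + 4 * slope\<^sup>2 - 4 * length_ratio) / length_ratio"
    unfolding n by (simp add: algebra_simps)
  also have "\<dots> = 2 * (of_nat c - 2)"
    unfolding s using length_ratio_neq_0 by (simp add: field_simps)
  finally have x: "2 * ?x = of_nat c - 2" using two_neq_0 by (metis mult_left_cancel)
  have y: "?y \<noteq> 0" if "(of_nat c :: 'p mod_ring) \<noteq> 0"
  proof -
    have "4 * slope\<^sup>2 \<noteq> 0" unfolding s using that length_ratio_neq_0 by simp
    then have "slope \<noteq> 0" by auto
    then show ?thesis unfolding n using two_neq_0 length_ratio_neq_0 by simp
  qed
  have "the_enat l = 2 \<and> ?x = -1 \<or> the_enat l = 3 \<and> 2 * ?x = -1 \<and> ?y \<noteq> 0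
      \<or> the_enat l = 4 \<and> ?x = 0 \<and> ?y \<noteq> 0 \<or> the_enat l = 6 \<and> 2 * ?x = 1 \<and> ?y \<noteq> 0"
  proof -
    consider "l = 2" | "l = 3" | "l = 4" | "l = 6" using l by blast
    then show ?thesis
    proof cases
      case 1
      have "2 * ?x = 2 * (-1)" unfolding x c_def 1 by simp
      then have "?x = -1" using two_neq_0 by (metis mult_left_cancel)
      moreover have "the_enat l = 2" by (simp add: 1 numeral_eq_enat)
      ultimately show ?thesis by blast
    next
      case 2
      have c: "c = 1" by (simp add: c_def 2)
      have "2 * ?x = -1" unfolding x c by simp
      moreover have "?y \<noteq> 0" by (rule y) (simp add: c)
      moreover have "the_enat l = 3" by (simp add: 2 numeral_eq_enat)
      ultimately show ?thesis by blast
    next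
      case 3
      have c: "c = 2" by (simp add: c_def 3)
      have "2 * ?x = 2 * 0" unfolding x c by simp
      then have "?x = 0" using two_neq_0 by (metis mult_left_cancel)
      moreover have "?y \<noteq> 0" by (rule y) (simp add: c two_neq_0)
      moreover have "the_enat l = 4" by (simp add: 3 numeral_eq_enat)
      ultimately show ?thesis by blast
    next
      case 4
      have c: "c = 3" by (simp add: c_def 4)
      have "CARD('p) \<noteq> 3" using generic 4 unfolding generic_prime_def by auto
      then have "\<not> CARD('p) dvd 3" using card_ge_3 by (auto dest: dvd_imp_le)
      then have three: "(of_nat 3 :: 'p mod_ring) \<noteq> 0" using of_nat_0_mod_ring_dvd by blast
      have "2 * ?x = 1" unfolding x c by simp
      moreover have "?y \<noteq> 0" by (rule y) (simp only: c three not_False_eq_True)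
      moreover have "the_enat l = 6" by (simp add: 4 numeral_eq_enat)
      ultimately show ?thesis by blast
    qed
  qed
  note order = rot_order[OF xy this]
  have "the_enat l > 0" using l by (auto simp: numeral_eq_enat)
  then have "subgroup_on r {1, 2} = {rot ?x ?y ^^ n | n. n < the_enat l}
      \<union> {rot ?x ?y ^^ n \<circ> r 1 | n. n < the_enat l}"
    using order(1) by (intro subgroup_on_two[OF rho])
  then show "card (subgroup_on r {1, 2}) = 2 * the_enat l"
    using card_dihedral[OF xy order(2)] by (simp only: r_eq_refl)
qed

text \<open>
  The plane contains roots of every nonzero norm, so whichever class of reflections the group
  contains, it has a root \<open>a\<close> of this class in the plane. The square of a rotation is the product of the
  reflections along \<open>a\<close> and along a rotated copy of \<open>a\<close>, which has the same norm.
\<close>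

lemma rot_squares_in_group:
  assumes I: "{1, 2} \<subseteq> I" and ns: "nonsingular f (coord_space I)"
    and type: "orthogonal_type f (coord_space I) (acting_on (subgroup_on r I) (coord_space I))"
    and xy: "(x, y) \<in> conic"
  shows "(\<lambda>(x, y). rot x y) (conic_square (x, y)) \<in> subgroup_on r I"
proof -
  obtain c where c: "c \<noteq> 0" "\<And>a. a \<in> coord_space I \<Longrightarrow> f a a = c \<Longrightarrow> refl f a \<in> subgroup_on r I"
    using orthogonal_type_reflections[OF symmetric_form_axioms subspace_coord_space ns
        subgroup_on_isometries type] by blast
  have sub: "plane \<subseteq> coord_space I"
    unfolding plane_eq_coord_space by (rule coord_space_mono[OF I])
  obtain a1 a2 where a: "f (pt a1 a2) (pt a1 a2) = c" using plane_represents by blast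
  have rot: "rot x (- y) \<in> isometries_along plane"
    using xy by (intro rot_isometries_along conic_conj)
  have "refl f (pt a1 a2) \<in> subgroup_on r I"
    using a sub pt_in_plane by (intro c(2)) auto
  moreover have "refl f (rot x (- y) (pt a1 a2)) \<in> subgroup_on r I"
  proof (rule c(2))
    show "rot x (- y) (pt a1 a2) \<in> coord_space I"
      using isometries_along_preserves[OF subspace_plane rot pt_in_plane] sub by blast
    show "f (rot x (- y) (pt a1 a2)) (rot x (- y) (pt a1 a2)) = c"
      using isometries_alongD(4)[OF rot] a by simp
  qed
  ultimately have "refl f (pt a1 a2) \<circ> refl f (rot x (- y) (pt a1 a2)) \<in> subgroup_on r I"
    by (rule subgroup_on_comp)
  then show ?thesis
    using rot_square_eq_refl_refl[OF _ xy, of a1 a2] a c(1) by simp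
qed

text \<open>
  Squares of rotations make up at least half of the rotations, and multiplying them by the
  reflection \<open>r 1\<close> doubles their number.
\<close>

lemma card_Int_ge:
  assumes "\<And>x y. (x, y) \<in> conic \<Longrightarrow> (\<lambda>(x, y). rot x y) (conic_square (x, y)) \<in> subgroup_on r I"
    and "\<And>x y. (x, y) \<in> conic \<Longrightarrow> (\<lambda>(x, y). rot x y) (conic_square (x, y)) \<in> subgroup_on r J"
    and "1 \<in> I" "1 \<in> J"
  shows "card conic \<le> card (subgroup_on r I \<inter> subgroup_on r J)"
proof -
  let ?S = "conic_square ` conic"
  have in_I: "rot u v \<in> subgroup_on r I \<inter> subgroup_on r J" if uv: "(u, v) \<in> ?S" for u v
  proof -
    obtain x y where "(x, y) \<in> conic" "(u, v) = conic_square (x, y)" using uv by force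
    then show ?thesis using assms(1,2)[of x y] by simp
  qed
  moreover have "rot u v \<circ> refl1 \<in> subgroup_on r I \<inter> subgroup_on r J" if "(u, v) \<in> ?S" for u v
    using in_I[OF that] subgroup_on_r[OF assms(3)] subgroup_on_r[OF assms(4)] subgroup_on_comp
    by (simp add: r_eq_refl)
  ultimately have "(\<lambda>(x, y). rot x y) ` ?S \<union> (\<lambda>(x, y). rot x y \<circ> refl1) ` ?S
      \<subseteq> subgroup_on r I \<inter> subgroup_on r J"
    by (intro Un_least image_subsetI) (simp_all only: split_paired_all case_prod_conv)
  then have "2 * card ?S \<le> card (subgroup_on r I \<inter> subgroup_on r J)"
    unfolding card_rotations_reflections[OF conic_square_in_conic, symmetric]
    by (intro card_mono) auto
  then show ?thesis using card_conic_squares by linarith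
qed

end

theorem corollary3p1:
  fixes k l m :: enat
    and B :: "real ^ 4 \<Rightarrow> real ^ 4 \<Rightarrow> real"
    and b :: "4 \<Rightarrow> real ^ 4"
    and f :: "'p::prime_card mod_ring ^ 4 \<Rightarrow> 'p mod_ring ^ 4 \<Rightarrow> 'p mod_ring"
    and r :: "4 \<Rightarrow> 'p mod_ring ^ 4 \<Rightarrow> 'p mod_ring ^ 4"
  assumes basic: "basic_system k l m B b"
    and f_def: "f = red_form B b"
    and r_def: "r = red_refl B b"
    and generic: "generic_prime CARD('p) k l m"
    and nonsing: "nonsingular f UNIV"
    and nonsing_0: "nonsingular f (subspace_omit {0})"
    and nonsing_3: "nonsingular f (subspace_omit {3})"
    and nonsing_03: "nonsingular f (subspace_omit {0, 3})"
    and type_0: "orthogonal_type f (subspace_omit {0})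
                   (acting_on (subgroup_omit r {0}) (subspace_omit {0}))"
    and type_3: "orthogonal_type f (subspace_omit {3})
                   (acting_on (subgroup_omit r {3}) (subspace_omit {3}))"
  shows "(int CARD('p) > 2 * int (the_enat l) + eps f (subspace_omit {0, 3}) \<longrightarrow> \<not> C_group r)
    \<and> (acting_on (subgroup_omit r {0}) (subspace_omit {0}) = orth_group f (subspace_omit {0}) \<and>
       acting_on (subgroup_omit r {3}) (subspace_omit {3}) = orth_group f (subspace_omit {3})
       \<longrightarrow> (C_group r \<longleftrightarrow> int CARD('p) = int (the_enat l) + eps f (subspace_omit {0, 3})))"
proof -
  have 12: "- {0, 3} = {1, 2::4}" "- {0} \<inter> - {3} = {1, 2::4}" using nodes by auto
  interpret nonsingular_middle k l m B b f r
    using basic f_def r_def generic nonsing_03 unfolding subspace_omit_eq 12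
    by unfold_locales
  let ?H0 = "subgroup_on r (- {0})" and ?H3 = "subgroup_on r (- {3})" and ?D = "subgroup_on r {1, 2}"
  have eps: "eps f (subspace_omit {0, 3}) = eps f plane"
    unfolding subspace_omit_eq 12 plane_eq_coord_space ..
  have sub: "?D \<subseteq> ?H0 \<inter> ?H3"
    unfolding 12(2)[symmetric] by (intro Int_greatest subgroup_on_mono) auto
  have C_iff: "C_group r \<longleftrightarrow> ?H0 \<inter> ?H3 = ?D"
    unfolding C_group_iff using sub by blast
  have in_12: "1 \<in> - {0::4}" "1 \<in> - {3::4}" "{1, 2} \<subseteq> - {0::4}" "{1, 2} \<subseteq> - {3::4}" by auto
  note omit = subspace_omit_eq subgroup_omit_def
  have "\<not> C_group r" if large: "int CARD('p) > 2 * int (the_enat l) + eps f plane"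
  proof
    assume "C_group r"
    then have "card conic \<le> card ?D"
      using card_Int_ge[OF rot_squares_in_group rot_squares_in_group, of "- {0}" "- {3}"]
        in_12 nonsing_0 nonsing_3 type_0 type_3 unfolding omit C_iff by simp
    then show False using large card_conic_eps dihedral_group(2) by simp
  qed
  moreover have "C_group r \<longleftrightarrow> int CARD('p) = int (the_enat l) + eps f plane"
    if full: "acting_on ?H0 (coord_space (- {0})) = orth_group f (coord_space (- {0}))"
      "acting_on ?H3 (coord_space (- {3})) = orth_group f (coord_space (- {3}))"
  proof -
    have "?H0 = isometries_along (coord_space (- {0}))"
      using nonsing_0 full(1) unfolding omit
      by (intro eq_isometries_along_if_acts_as_orth_group subspace_coord_space subgroup_on_isometries)
    moreover have "?H3 = isometries_along (coord_space (- {3}))"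
      using nonsing_3 full(2) unfolding omit
      by (intro eq_isometries_along_if_acts_as_orth_group subspace_coord_space subgroup_on_isometries)
    ultimately have Int: "?H0 \<inter> ?H3 = isometries_along plane"
      by (simp only: isometries_along_Int coord_space_Int 12 plane_eq_coord_space)
    have "C_group r \<longleftrightarrow> card ?D = card (isometries_along plane)"
      unfolding C_iff Int using dihedral_group(1) by (metis card_subset_eq finite)
    also have "\<dots> \<longleftrightarrow> int (the_enat l) = int (card conic)"
      unfolding card_isometries_along_plane dihedral_group(2) by simp
    also have "\<dots> \<longleftrightarrow> int CARD('p) = int (the_enat l) + eps f plane"
      unfolding card_conic_eps CARD_mod_ring by linarith
    finally show ?thesis .
  qed
  ultimately show ?thesis unfolding eps unfolding omit by blast
qed

end
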